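(* Let $r\ge 1$ and let $y_{k+1}=\theta^T\varphi_k+w_{k+1}$, $k\ge 0$, be the stochastic system described in the context, with unknown deterministic parameter vector $\theta=[\theta(1),\dots,\theta(r)]^T\in\mathbb{R}^r$ and $A^*=\{j\in\{1,\dots,r\}: \theta(j)=0\}$. Let $\lambda_{\max}(N)$ and $\lambda_{\min}(N)$ be the maximal and minimal eigenvalues of $\sum_{k=1}^N\varphi_k\varphi_k^T$. Assume: (A1) $\{w_k,\mathcal{F}_k\}_{k\ge1}$ is a martingale difference sequence, i.e. $\mathbb{E}[w_{k+1}\mid\mathcal{F}_k]=0$ for $k\ge1$, and there is $\gamma>2$ such that $\sup_k\mathbb{E}[|w_{k+1}|^\gamma\mid\mathcal{F}_k]<\infty$ almost surely. (A2) For each $k\ge1$, $\varphi_k$ is $\mathcal{F}_k$-measurable. (A3) $\displaystyle \frac{\lambda_{\max}(N)}{\lambda_{\min}(N)}\sqrt{\frac{\log\lambda_{\max}(N)}{\lambda_{\min}(N)}}\to 0$ almost surely as $N\to\infty$. (A4) $\{\lambda_N\}$ is a (possibly sample-path dependent) positive sequence tending to infinity such that, almost surely as $N\to\infty$, $$\lambda_N=o(\lambda_{\min}(N)),\qquad \lambda_{\max}(N)\sqrt{\frac{\log\lambda_{\max}(N)}{\lambda_{\min}(N)}}=o(\lambda_N).$$ Let $\beta_{N+1}$ be the sparse estimate defined in the context, computed from $\{\varphi_k,y_{k+1}\}_{k=1}^N$ with the coefficients $\lambda_N$. Then there exists an event $\Omega_0$ with $\mathbb{P}\{\Omega_0\}=1$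 such that for every $\omega\in\Omega_0$ there is an integer $N_0(\omega)$ with $$\beta_{N+1}(j)=0\quad\text{for all } j\in A^* \text{ and all } N\ge N_0(\omega),$$ and $$\beta_{N+1}(i)\to\theta(i)\ \text{ as } N\to\infty,\ \text{ almost surely, for every } i\in\{1,\dots,r\}\setminus A^*.$$
   Context: All random variables live on a probability space $(\Omega,\mathscr{F},\mathbb{P})$. In the system $y_{k+1}=\theta^T\varphi_k+w_{k+1}$, $k\ge0$, $y_{k+1}\in\mathbb{R}$ is the output, $w_{k+1}\in\mathbb{R}$ the noise, and $\varphi_k\in\mathbb{R}^r$ the (random) regressor, which may be formed from current and past inputs $u_k$ and outputs (feedback is allowed). With $\{u_k\}$ the system inputs and $\{w'_k\}$ a sequence of exogenous input signals, $$\mathcal{F}_k=\sigma\{y_k,\dots,y_0,\,u_{k-1},\dots,u_0,\,w_k,\dots,w_0,\,w'_k,\dots,w'_0\},\quad k\ge1.$$ Sign convention: $\mathrm{sgn}(x)=1$ if $x\ge0$ and $\mathrm{sgn}(x)=-1$ if $x<0$. Sparse estimate (defined whenever the expressions below make sense; the asymptotic statements concern large $N$). Step 1. The least squares estimate is $$\theta_{N+1}=\Big(\sum_{k=1}^N\varphi_k\varphi_k^T\Big)^{-1}\Big(\sum_{k=1}^N\varphi_ky_{k+1}\Big)=[\theta_{N+1}(1),\dots,\theta_{N+1}(r)]^T,$$ and, for $j=1,\dots,r$, $$\widehat\theta_{N+1}(j)=\theta_{N+1}(j)+\mathrm{sgn}(\theta_{N+1}(j))\sqrt{\frac{\log\lambda_{\max}(N)}{\lambda_{\min}(N)}}.$$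 Step 2. For $\beta=[\beta(1),\dots,\beta(r)]^T\in\mathbb{R}^r$, $$J_{N+1}(\beta)=\sum_{k=1}^N(y_{k+1}-\beta^T\varphi_k)^2+\lambda_N\sum_{l=1}^r\frac{1}{|\widehat\theta_{N+1}(l)|}|\beta(l)|,$$ and $\beta_{N+1}=[\beta_{N+1}(1),\dots,\beta_{N+1}(r)]^T=\mathrm{argmin}_{\beta\in\mathbb{R}^r}J_{N+1}(\beta)$. *)

theory Defs
  imports "HOL-Probability.Probability" "HOL-Library.Landau_Symbols"
begin

definition observation_algebra ::
    "'a measure \<Rightarrow> (nat \<Rightarrow> 'a \<Rightarrow> real) \<Rightarrow> (nat \<Rightarrow> 'a \<Rightarrow> 'u::topological_space) \<Rightarrow>
     (nat \<Rightarrow> 'a \<Rightarrow> real) \<Rightarrow> (nat \<Rightarrow> 'a \<Rightarrow> 'v::topological_space) \<Rightarrow> nat \<Rightarrow> 'a measure" where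
  "observation_algebra M y u w w' k = sigma (space M)
     ((\<Union>i\<in>{0..k}. sets (vimage_algebra (space M) (y i) borel)) \<union>
      (\<Union>i\<in>{0..<k}. sets (vimage_algebra (space M) (u i) borel)) \<union>
      (\<Union>i\<in>{0..k}. sets (vimage_algebra (space M) (w i) borel)) \<union>
      (\<Union>i\<in>{0..k}. sets (vimage_algebra (space M) (w' i) borel)))"

definition martingale_difference ::
    "'a measure \<Rightarrow> (nat \<Rightarrow> 'a measure) \<Rightarrow> (nat \<Rightarrow> 'a \<Rightarrow> real) \<Rightarrow> bool" where
  "martingale_difference M F w \<longleftrightarrow>
     (\<forall>k\<ge>1. w k \<in> borel_measurable (F k) \<and> integrable M (w k)) \<and>
     (\<forall>k\<ge>1. AE \<omega> in M. real_cond_exp M (F k) (w (k + 1)) \<omega> = 0)"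

(* Differs from the library's sgn at 0. *)
definition sign :: "real \<Rightarrow> real" where
  "sign x = (if x \<ge> 0 then 1 else -1)"

definition eigenvalues :: "real ^ 'r ^ 'r \<Rightarrow> real set" where
  "eigenvalues A = {l. \<exists>v. v \<noteq> 0 \<and> A *v v = l *\<^sub>R v}"

definition outer :: "real ^ 'r \<Rightarrow> real ^ 'r \<Rightarrow> real ^ 'r ^ 'r" where
  "outer v z = (\<chi> i j. v $ i * z $ j)"

(* In what follows x and y are single sample paths of regressors and outputs. *)

definition gram :: "(nat \<Rightarrow> real ^ 'r) \<Rightarrow> nat \<Rightarrow> real ^ 'r ^ 'r" where
  "gram x N = (\<Sum>k=1..N. outer (x k) (x k))"

(* The Gram matrix is symmetric, so its set of real eigenvalues is finite and nonempty. *)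
definition lambda_max :: "(nat \<Rightarrow> real ^ 'r) \<Rightarrow> nat \<Rightarrow> real" where
  "lambda_max x N = Max (eigenvalues (gram x N))"

definition lambda_min :: "(nat \<Rightarrow> real ^ 'r) \<Rightarrow> nat \<Rightarrow> real" where
  "lambda_min x N = Min (eigenvalues (gram x N))"

(* The estimates below are indexed by the time N + 1 at which y (N + 1) becomes available:
   ls_estimate x y N is theta_{N+1}, and likewise for the others. They are meaningful when
   lambda_min x N > 0 and lambda_max x N > 1; otherwise matrix_inv, division by zero, sqrt of a negative number or
   arg_min yield values without meaning. *)

definition ls_estimate :: "(nat \<Rightarrow> real ^ 'r) \<Rightarrow> (nat \<Rightarrow> real) \<Rightarrow> nat \<Rightarrow> real ^ 'r" where
  "ls_estimate x y N = matrix_inv (gram x N) *v (\<Sum>k=1..N. y (k + 1) *\<^sub>R x k)"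

definition shifted_estimate :: "(nat \<Rightarrow> real ^ 'r) \<Rightarrow> (nat \<Rightarrow> real) \<Rightarrow> nat \<Rightarrow> real ^ 'r" where
  "shifted_estimate x y N = (\<chi> j. ls_estimate x y N $ j +
     sign (ls_estimate x y N $ j) * sqrt (ln (lambda_max x N) / lambda_min x N))"

definition lasso_cost ::
    "(nat \<Rightarrow> real ^ 'r) \<Rightarrow> (nat \<Rightarrow> real) \<Rightarrow> (nat \<Rightarrow> real) \<Rightarrow> nat \<Rightarrow> real ^ 'r \<Rightarrow> real" where
  "lasso_cost x y lam N \<beta> =
     (\<Sum>k=1..N. (y (k + 1) - \<beta> \<bullet> x k)\<^sup>2) +
     lam N * (\<Sum>l\<in>UNIV. 1 / \<bar>shifted_estimate x y N $ l\<bar> * \<bar>\<beta> $ l\<bar>)"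

definition sparse_estimate ::
    "(nat \<Rightarrow> real ^ 'r) \<Rightarrow> (nat \<Rightarrow> real) \<Rightarrow> (nat \<Rightarrow> real) \<Rightarrow> nat \<Rightarrow> real ^ 'r" where
  "sparse_estimate x y lam N = arg_min (lasso_cost x y lam N) (\<lambda>\<beta>. True)"

end

(* For the oracle weights one needs the rate |theta_{N+1} - theta| = O(delta_N), where
   delta_N = sqrt (ln lambda_max / lambda_min), of Lai and Wei. Let S_N be the sum of w_{k+1} phi_k and
   Q_N = S_N . (I + G_N)^{-1} S_N, with G_N the Gram matrix. Sherman-Morrison gives a recursion for Q_N whose
   terms are a negative drift -h_k, a martingale dominated by that drift, and a_k w_{k+1}^2 with
   sum a_k <= ln det (I + G_N) = O(ln lambda_max). Both martingales involved are controlled on almost every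
   path by Doob's maximal inequality for a suitably normalized power, without a convergence theorem.

   Given the rate, |shifted estimate| is O(delta_N) on the zero coordinates and bounded away from 0 on
   the others. Comparing the cost at its minimiser with the cost at theta yields
   lambda_min |beta - theta| = O(lambda_N), hence consistency. If a zero coordinate of theta were estimated by a
   nonzero number, deleting it would lower the penalty by at least a multiple of lambda_N / delta_N per unit
   and raise the residual sum of squares by at most O(lambda_max (|beta - theta| + delta_N)) per unit, which is
   of smaller order. *)

theory Submission
  imports Defs
begin

text \<open>The identity is added to the Gram matrix because the latter may be singular at early
  times; the price, a term |d|^2 in the final comparison, is absorbed once lambda_min is at least 1.
  The main obstacle is the weak moment assumption. With only gamma > 2 conditional moments, the
  centred squares of the noise have moments of an order p > 1 that may lie below 2, so an expansion
  of p-th powers takes the place of L2 arguments. The bound on the conditional moments is moreover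
  random, whence the localization by predictable indicators. The normalizers are random too, but
  increasing and predictable: a martingale divided by such a process is an autoregression with
  factors in [0,1], and its p-th power is a supermartingale up to summable errors.\<close>

subsection \<open>Real inequalities\<close>

text \<open>After division by \<open>a + b\<close> both summands lie in the unit interval, where
  \<open>t <= t powr q\<close>. Below it serves as the Hoelder continuity of
  \<open>t powr (p - 1)\<close>.\<close>

lemma powr_add_le:
  fixes a b q :: real
  assumes "0 \<le> a" "0 \<le> b" "0 < q" "q \<le> 1"
  shows "(a + b) powr q \<le> a powr q + b powr q"
proof (cases "a + b = 0")
  case False
  then have pos: "a + b > 0"
    using assms by simp
  have "t \<le> t powr q" if "0 \<le> t" "t \<le> 1" for t
    using powr_mono'[of q 1 t] that assms by (cases "t = 0") auto
  then have "a / (a + b) + b / (a + b) \<le> (a / (a + b)) powr q + (b / (a + b)) powr q"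
    using assms pos by (intro add_mono) auto
  then have "1 \<le> (a powr q + b powr q) / (a + b) powr q"
    using assms pos by (simp add: powr_divide add_divide_distrib[symmetric])
  then show ?thesis
    using pos by (simp add: le_divide_eq)
qed (use assms in auto)

text \<open>Replacing both numbers by their maximum gives a crude Young inequality. It makes the
  cross term of the p-th power expansion integrable.\<close>

lemma powr_mult_le_powr_add:
  fixes a b p :: real
  assumes "0 \<le> a" "0 \<le> b" "1 < p"
  shows "a powr (p - 1) * b \<le> a powr p + b powr p"
proof -
  define m where "m = max a b"
  have "a powr (p - 1) * b \<le> m powr (p - 1) * m"
    using assms by (intro mult_mono powr_mono2) (auto simp: m_def)
  also have "\<dots> = m powr p"
    using assms powr_add[of m "p - 1" 1] by (cases "m = 0") (auto simp: m_def)
  also have "\<dots> \<le> a powr p + b powr p"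
    by (auto simp: m_def max_def)
  finally show ?thesis .
qed

lemma abs_add_powr_le:
  fixes a b p :: real
  assumes "0 < p"
  shows "\<bar>a + b\<bar> powr p \<le> 2 powr p * (\<bar>a\<bar> powr p + \<bar>b\<bar> powr p)"
proof -
  define m where "m = max \<bar>a\<bar> \<bar>b\<bar>"
  have "\<bar>a + b\<bar> powr p \<le> (2 * m) powr p"
    using assms by (intro powr_mono2) (auto simp: m_def)
  also have "\<dots> = 2 powr p * m powr p"
    by (simp add: powr_mult m_def)
  also have "m powr p \<le> \<bar>a\<bar> powr p + \<bar>b\<bar> powr p"
    by (auto simp: m_def max_def)
  finally show ?thesis
    by simp
qed

text \<open>The inequality behind the von Bahr--Esseen moment bound for martingales.\<close>

lemma abs_add_powr_le_taylor:
  fixes x y p :: real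
  assumes p: "1 < p" "p \<le> 2"
  shows "\<bar>x + y\<bar> powr p \<le> \<bar>x\<bar> powr p + p * (sgn x * \<bar>x\<bar> powr (p - 1)) * y + 3 * \<bar>y\<bar> powr p"
proof -
  \<comment> \<open>Both sides are invariant under changing the signs of \<open>x\<close> and
    \<open>y\<close>, so nonnegative \<open>x\<close> suffices. While \<open>x + y\<close> stays
    nonnegative, the mean value theorem applies, and the derivative differs from its value at
    \<open>x\<close> by at most \<open>p * |y| powr (p - 1)\<close>.\<close>
  have nonneg: "\<bar>x + y\<bar> powr p \<le> x powr p + p * x powr (p - 1) * y + 3 * \<bar>y\<bar> powr p"
    if x: "0 \<le> x" for x y :: real
  proof -
    have split: "\<bar>y\<bar> powr p = \<bar>y\<bar> powr (p - 1) * \<bar>y\<bar>"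
      using powr_add[of "\<bar>y\<bar>" "p - 1" 1] by (cases "y = 0") auto
    have mvt: "\<exists>\<xi>. a < \<xi> \<and> \<xi> < b \<and> b powr p - a powr p = (b - a) * (p * \<xi> powr (p - 1))"
      if "0 \<le> a" "a < b" for a b
    proof -
      have cont: "continuous_on {a..b} (\<lambda>t. t powr p)"
        using that p by (intro continuous_on_powr' continuous_intros) auto
      have der: "((\<lambda>t. t powr p) has_real_derivative p * t powr (p - 1)) (at t)" if "a < t" for t
        using that \<open>0 \<le> a\<close> by (intro has_real_derivative_powr) auto
      obtain l \<xi> where "a < \<xi>" "\<xi> < b" "((\<lambda>t. t powr p) has_real_derivative l) (at \<xi>)"
          "b powr p - a powr p = (b - a) * l"
        using MVT[OF \<open>a < b\<close> cont] der real_differentiable_def by metis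
      with DERIV_unique[OF _ der] show ?thesis
        by metis
    qed
    consider "y = 0" | "y > 0" | "y < 0" "0 \<le> x + y" | "x + y < 0"
      by linarith
    then show ?thesis
    proof cases
      case 2
      then obtain \<xi> where \<xi>: "x < \<xi>" "\<xi> < x + y" "(x + y) powr p - x powr p = y * (p * \<xi> powr (p - 1))"
        using mvt[of x "x + y"] x by auto
      have "\<xi> powr (p - 1) \<le> (x + y) powr (p - 1)"
        using \<xi> x p by (intro powr_mono2) auto
      also have "\<dots> \<le> x powr (p - 1) + y powr (p - 1)"
        using x p 2 by (intro powr_add_le) auto
      finally have "(x + y) powr p - x powr p \<le> y * (p * (x powr (p - 1) + y powr (p - 1)))"
        unfolding \<xi> using 2 p by (intro mult_left_mono) auto
      also have "\<dots> = p * x powr (p - 1) * y + p * \<bar>y\<bar> powr p"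
        using 2 split by (simp add: algebra_simps)
      also have "\<dots> \<le> p * x powr (p - 1) * y + 3 * \<bar>y\<bar> powr p"
        using p by (intro add_left_mono mult_right_mono) auto
      finally show ?thesis
        using 2 x by simp
    next
      case 3
      then obtain \<xi> where \<xi>: "x + y < \<xi>" "\<xi> < x" "x powr p - (x + y) powr p = - y * (p * \<xi> powr (p - 1))"
        using mvt[of "x + y" x] by auto
      have "x powr (p - 1) \<le> \<xi> powr (p - 1) + (x - \<xi>) powr (p - 1)"
        using powr_add_le[of \<xi> "x - \<xi>" "p - 1"] \<xi> 3 p by simp
      also have "(x - \<xi>) powr (p - 1) \<le> \<bar>y\<bar> powr (p - 1)"
        using \<xi> p by (intro powr_mono2) auto
      finally have "- y * (p * (x powr (p - 1) - \<bar>y\<bar> powr (p - 1))) \<le> - y * (p * \<xi> powr (p - 1))"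
        using 3 p by (intro mult_left_mono) auto
      then have "(x + y) powr p \<le> x powr p + p * x powr (p - 1) * y + p * \<bar>y\<bar> powr p"
        using 3 split \<xi> by (simp add: algebra_simps)
      also have "\<dots> \<le> x powr p + p * x powr (p - 1) * y + 3 * \<bar>y\<bar> powr p"
        using p by (intro add_left_mono mult_right_mono) auto
      finally show ?thesis
        using 3 by simp
    next
      \<comment> \<open>The constant 3 arises here: \<open>x < |y|\<close>, so the linear term is at
        least \<open>- 2 * |y| powr p\<close>, and one further copy bounds
        \<open>|x + y| powr p\<close>.\<close>
      case 4
      have "x powr (p - 1) * \<bar>y\<bar> \<le> \<bar>y\<bar> powr (p - 1) * \<bar>y\<bar>"
        using 4 x p by (intro mult_right_mono powr_mono2) auto
      then have "p * (x powr (p - 1) * \<bar>y\<bar>) \<le> 2 * \<bar>y\<bar> powr p"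
        unfolding split using p mult_mono[of p 2 "x powr (p - 1) * \<bar>y\<bar>"] by auto
      moreover have "\<bar>x + y\<bar> powr p \<le> \<bar>y\<bar> powr p"
        using 4 x p by (intro powr_mono2) auto
      moreover have "p * x powr (p - 1) * y = - (p * (x powr (p - 1) * \<bar>y\<bar>))"
        using 4 x by simp
      ultimately show ?thesis
        using powr_ge_zero[of x p] by linarith
    qed (use x in auto)
  qed
  show ?thesis
  proof (cases "0 \<le> x")
    case True
    then show ?thesis
      using nonneg[of x y] by (cases "x = 0") auto
  next
    case False
    then show ?thesis
      using nonneg[of "- x" "- y"] by (simp add: abs_minus_commute add.commute)
  qed
qed

text \<open>Each term is the area of a rectangle under the graph of \<open>t powr - s\<close>
  between consecutive values of \<open>T\<close>; the integral from 1 to infinity is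
  \<open>1 / (s - 1)\<close>. This verifies the weight condition in both martingale bounds.\<close>

lemma sum_increments_powr_le:
  fixes T :: "nat \<Rightarrow> real"
  assumes s: "1 < s" and T: "\<And>n. 1 \<le> T n" "\<And>n. T n \<le> T (Suc n)"
  shows "(\<Sum>n<N. (T (Suc n) - T n) / T (Suc n) powr s) \<le> 1 / (s - 1)"
proof -
  \<comment> \<open>In place of integration, \<open>ln t <= t - 1\<close> and
    \<open>1 + t <= exp t\<close> bound \<open>(b / a) powr (s - 1)\<close> from below; then
    multiply by \<open>b powr (1 - s)\<close>.\<close>
  have step: "(s - 1) * ((b - a) / b powr s) \<le> a powr (1 - s) - b powr (1 - s)"
    if "1 \<le> a" "a \<le> b" for a b
  proof -
    have "1 + (s - 1) * (1 - a / b) \<le> 1 + (s - 1) * ln (b / a)"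
      using that s ln_le_minus_one[of "a / b"] by (simp add: ln_div)
    also have "\<dots> \<le> exp ((s - 1) * ln (b / a))"
      by (rule exp_ge_add_one_self)
    also have "\<dots> = (b / a) powr (s - 1)"
      using that by (simp add: powr_def)
    finally have "((s - 1) * (1 - a / b)) * b powr (1 - s) \<le> ((b / a) powr (s - 1) - 1) * b powr (1 - s)"
      by (intro mult_right_mono) auto
    also have "\<dots> = a powr (1 - s) - b powr (1 - s)"
      using that by (simp add: powr_divide powr_diff field_simps)
    also have "((s - 1) * (1 - a / b)) * b powr (1 - s) = (s - 1) * ((b - a) / b powr s)"
      using that by (simp add: powr_diff field_simps)
    finally show ?thesis .
  qed
  have "(s - 1) * (\<Sum>n<N. (T (Suc n) - T n) / T (Suc n) powr s) \<le> T 0 powr (1 - s) - T N powr (1 - s)"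
  proof (induction N)
    case (Suc N)
    then show ?case
      using step[OF T, of N] by (simp add: distrib_left)
  qed simp
  also have "\<dots> \<le> T 0 powr (1 - s)"
    by simp
  also have "\<dots> \<le> 1"
    using powr_mono2'[of "1 - s" 1 "T 0"] s T(1)[of 0] by simp
  finally show ?thesis
    using s by (simp add: field_simps)
qed

subsection \<open>Recursive ridge regression\<close>

text \<open>The Sherman--Morrison recursion for the inverse of the identity plus the Gram operator of
  \<open>x 0, \<dots>, x (n - 1)\<close>. In this form the adaptedness of all quantities built from the inverse is
  immediate, and no invertibility assumption is needed.\<close>

primrec ridge_inv :: "(nat \<Rightarrow> 'b::euclidean_space) \<Rightarrow> nat \<Rightarrow> 'b \<Rightarrow> 'b" where
  "ridge_inv x 0 u = u"
| "ridge_inv x (Suc n) u = ridge_inv x n u -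
     (ridge_inv x n (x n) \<bullet> u / (1 + x n \<bullet> ridge_inv x n (x n))) *\<^sub>R ridge_inv x n (x n)"

definition ridge_op :: "(nat \<Rightarrow> 'b::euclidean_space) \<Rightarrow> nat \<Rightarrow> 'b \<Rightarrow> 'b" where
  "ridge_op x n u = u + (\<Sum>k<n. (x k \<bullet> u) *\<^sub>R x k)"

definition score :: "(nat \<Rightarrow> 'b::euclidean_space) \<Rightarrow> (nat \<Rightarrow> real) \<Rightarrow> nat \<Rightarrow> 'b" where
  "score x v n = (\<Sum>k<n. v k *\<^sub>R x k)"

definition leverage :: "(nat \<Rightarrow> 'b::euclidean_space) \<Rightarrow> nat \<Rightarrow> real" where
  "leverage x n = x n \<bullet> ridge_inv x n (x n)"

text \<open>By symmetry of \<open>ridge_inv\<close> this is \<open>x n\<close> paired with the ridge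
  estimate \<open>ridge_inv x n (score x v n)\<close>, the value predicted for \<open>v n\<close>
  from earlier data.\<close>

definition innovation :: "(nat \<Rightarrow> 'b::euclidean_space) \<Rightarrow> (nat \<Rightarrow> real) \<Rightarrow> nat \<Rightarrow> real" where
  "innovation x v n = ridge_inv x n (x n) \<bullet> score x v n"

definition self_normalized :: "(nat \<Rightarrow> 'b::euclidean_space) \<Rightarrow> (nat \<Rightarrow> real) \<Rightarrow> nat \<Rightarrow> real" where
  "self_normalized x v n = score x v n \<bullet> ridge_inv x n (score x v n)"

text \<open>For vectors in \<open>real ^ 'r\<close> this is the logarithm of det (I + G), see
  \<open>det_ridge\<close>. The sum form exhibits its increments and its predictability.\<close>

definition log_volume :: "(nat \<Rightarrow> 'b::euclidean_space) \<Rightarrow> nat \<Rightarrow> real" where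
  "log_volume x n = (\<Sum>k<n. ln (1 + leverage x k))"

lemma linear_ridge_op: "linear (ridge_op x n)"
  by (rule linearI) (simp_all add: ridge_op_def inner_add sum.distrib algebra_simps scaleR_sum_right)

lemma ridge_op_ge: "u \<bullet> u \<le> u \<bullet> ridge_op x n u"
  by (auto simp: ridge_op_def inner_add inner_sum_right inner_commute intro!: sum_nonneg)

lemma ridge_op_psd: "0 \<le> u \<bullet> ridge_op x n u"
  using ridge_op_ge[of u x n] inner_ge_zero[of u] by linarith

lemma linear_ridge_inv: "linear (ridge_inv x n)"
proof (induction n)
  case 0
  then show ?case
    by (auto intro: linearI)
next
  case (Suc n)
  show ?case
    by (rule linearI)
      (simp_all add: linear_add[OF Suc] linear_scale[OF Suc] inner_add_right add_divide_distrib algebra_simps)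
qed

lemma ridge_inv_symmetric: "u \<bullet> ridge_inv x n v = ridge_inv x n u \<bullet> v"
  by (induction n arbitrary: u v) (simp_all add: inner_diff inner_commute)

text \<open>Sherman-Morrison needs \<open>1 + b\<close> to be nonzero. By the induction hypothesis
  \<open>x n = ridge_op x n q\<close>, so \<open>b\<close> is a value of the nonnegative form of
  \<open>ridge_op\<close>.\<close>

lemma ridge_op_inv: "ridge_op x n (ridge_inv x n u) = u"
proof (induction n arbitrary: u)
  case 0
  then show ?case
    by (simp add: ridge_op_def)
next
  case (Suc n)
  define q where "q = ridge_inv x n (x n)"
  define b where "b = x n \<bullet> q"
  have "0 \<le> q \<bullet> ridge_op x n q"
    by (rule ridge_op_psd)
  then have b: "b \<ge> 0"
    by (simp add: q_def Suc b_def inner_commute)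
  have A: "ridge_op x (Suc n) z = ridge_op x n z + (x n \<bullet> z) *\<^sub>R x n" for z
    by (simp add: ridge_op_def)
  define t where "t = q \<bullet> u / (1 + b)"
  have "x n \<bullet> ridge_inv x n u = q \<bullet> u"
    by (simp add: q_def ridge_inv_symmetric)
  then have "ridge_op x (Suc n) (ridge_inv x (Suc n) u) = u - t *\<^sub>R x n + (q \<bullet> u - t * b) *\<^sub>R x n"
    by (simp add: A linear_diff[OF linear_ridge_op] linear_scale[OF linear_ridge_op] Suc inner_diff_right
        flip: q_def b_def t_def)
      (simp add: q_def Suc algebra_simps)
  also have "q \<bullet> u - t * b = t"
    using b by (simp add: t_def field_simps)
  finally show ?case
    by simp
qed

lemma ridge_inv_psd: "0 \<le> u \<bullet> ridge_inv x n u"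
  using ridge_op_psd[of "ridge_inv x n u" x n] by (simp add: ridge_op_inv inner_commute)

lemma leverage_nonneg: "0 \<le> leverage x n"
  by (simp add: leverage_def ridge_inv_psd)

lemma log_volume_Suc: "log_volume x (Suc n) = log_volume x n + ln (1 + leverage x n)"
  by (simp add: log_volume_def)

lemma log_volume_nonneg: "0 \<le> log_volume x n"
  by (auto simp: log_volume_def leverage_nonneg intro!: sum_nonneg)

text \<open>The left side is the weight of the squared noise in the recursion, the right side the
  increment of \<open>log_volume\<close>.\<close>

lemma leverage_ratio_le_ln: "leverage x n / (1 + leverage x n) \<le> ln (1 + leverage x n)"
  using ln_le_minus_one[of "1 / (1 + leverage x n)"] leverage_nonneg[of x n]
  by (simp add: ln_div field_simps)

text \<open>With the old inverse the new score has the form \<open>Q + 2 * g * v + b * v^2\<close>;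
  the rank-one correction subtracts \<open>(g + b * v)^2 / (1 + b)\<close>, and over the common
  denominator the terms with an extra factor \<open>b\<close> cancel.\<close>

lemma self_normalized_Suc:
  fixes x :: "nat \<Rightarrow> 'b::euclidean_space" and v n
  defines "b \<equiv> leverage x n" and "g \<equiv> innovation x v n"
  shows "self_normalized x v (Suc n) =
    self_normalized x v n - g\<^sup>2 / (1 + b) + 2 * g / (1 + b) * v n + b / (1 + b) * (v n)\<^sup>2"
proof -
  define S where "S = score x v n"
  define q where "q = ridge_inv x n (x n)"
  have b: "1 + b \<noteq> 0"
    using leverage_nonneg[of x n] by (simp add: b_def)
  have S: "score x v (Suc n) = S + v n *\<^sub>R x n"
    by (simp add: score_def S_def)
  have inv: "ridge_inv x n (S + v n *\<^sub>R x n) = ridge_inv x n S + v n *\<^sub>R q"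
    by (simp add: linear_add[OF linear_ridge_inv] linear_scale[OF linear_ridge_inv] q_def)
  have gS: "q \<bullet> S = g" "x n \<bullet> q = b"
    by (simp_all add: g_def q_def S_def innovation_def leverage_def b_def)
  moreover have "x n \<bullet> ridge_inv x n S = g"
    using gS(1) ridge_inv_symmetric[of "x n" x n S] by (simp add: q_def)
  ultimately have gS: "q \<bullet> S = g" "S \<bullet> q = g" "x n \<bullet> ridge_inv x n S = g" "x n \<bullet> q = b" "q \<bullet> x n = b"
    by (metis inner_commute)+
  have "self_normalized x v (Suc n) =
      (S + v n *\<^sub>R x n) \<bullet> (ridge_inv x n S + v n *\<^sub>R q) - (q \<bullet> (S + v n *\<^sub>R x n))\<^sup>2 / (1 + b)"
    by (simp add: self_normalized_def S inv inner_diff_right power2_eq_square inner_commute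
        flip: q_def) (simp add: gS)
  also have "\<dots> = self_normalized x v n + (2 * g * v n + b * (v n)\<^sup>2 - (g + b * v n)\<^sup>2 / (1 + b))"
    by (simp add: inner_add gS power2_eq_square self_normalized_def S_def[symmetric] algebra_simps)
  also have "2 * g * v n + b * (v n)\<^sup>2 - (g + b * v n)\<^sup>2 / (1 + b)
      = ((2 * g * v n + b * (v n)\<^sup>2) * (1 + b) - (g + b * v n)\<^sup>2) / (1 + b)"
    using b by (simp add: diff_divide_distrib)
  also have "(2 * g * v n + b * (v n)\<^sup>2) * (1 + b) - (g + b * v n)\<^sup>2 = - g\<^sup>2 + 2 * g * v n + b * (v n)\<^sup>2"
    by (simp add: power2_eq_square algebra_simps)
  finally show ?thesis
    by (simp add: add_divide_distrib diff_divide_distrib)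
qed

text \<open>Completing the square: the form of \<open>ridge_inv\<close> is nonnegative at the score
  minus \<open>ridge_op x n u\<close>. The right side is the maximum of the left over
  \<open>u\<close>, so \<open>u\<close> can be chosen to suit the application.\<close>

lemma self_normalized_lower_bound:
  "2 * (u \<bullet> score x v n) - u \<bullet> ridge_op x n u \<le> self_normalized x v n"
proof -
  define S where "S = score x v n"
  define z where "z = S - ridge_op x n u"
  \<comment> \<open>The right inverse is also a left inverse because \<open>ridge_op\<close>
    dominates the identity and is thus injective.\<close>
  have inv: "ridge_inv x n (ridge_op x n u) = u"
  proof -
    define d where "d = ridge_inv x n (ridge_op x n u) - u"
    have "ridge_op x n d = 0"
      by (simp add: d_def linear_diff[OF linear_ridge_op] ridge_op_inv)
    then have "d \<bullet> d \<le> 0"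
      using ridge_op_ge[of d x n] by simp
    then have "d = 0"
      by (metis inner_eq_zero_iff inner_ge_zero order_antisym)
    then show ?thesis
      by (simp add: d_def)
  qed
  have "0 \<le> z \<bullet> ridge_inv x n z"
    by (rule ridge_inv_psd)
  also have "\<dots> = S \<bullet> ridge_inv x n S - 2 * (u \<bullet> S) + u \<bullet> ridge_op x n u"
    using ridge_inv_symmetric[of "ridge_op x n u" x n S]
    by (simp add: z_def linear_diff[OF linear_ridge_inv] inv inner_diff inner_commute)
  finally show ?thesis
    by (simp add: self_normalized_def S_def)
qed

subsection \<open>Almost sure boundedness of weighted martingales\<close>

locale filtered_prob_space = prob_space M for M :: "'a measure" +
  fixes F :: "nat \<Rightarrow> 'a measure"
  assumes subalgebra: "subalgebra M (F n)"
    and sets_F_mono: "sets (F n) \<subseteq> sets (F (Suc n))"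
begin

lemma sigma_finite_F: "sigma_finite_subalgebra M (F n)"
  by (intro finite_measure_subalgebra_is_sigma_finite finite_measure_subalgebra.intro
      finite_measure_subalgebra_axioms.intro subalgebra finite_measure_axioms)

lemma space_F: "space (F n) = space M"
  using subalgebra by (simp add: subalgebra_def)

lemma measurable_F_Suc: "f \<in> measurable (F n) N \<Longrightarrow> f \<in> measurable (F (Suc n)) N"
  using sets_F_mono[of n] by (auto simp: measurable_def space_F)

lemma measurable_F_M: "f \<in> measurable (F n) N \<Longrightarrow> f \<in> measurable M N"
  by (rule measurable_from_subalg[OF subalgebra])

lemma sets_F_M: "A \<in> sets (F n) \<Longrightarrow> A \<in> sets M"
  using subalgebra by (auto simp: subalgebra_def)

text \<open>Doob's argument for a supermartingale up to errors \<open>\<epsilon> n\<close>. The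
  drift is phrased by integrals over events of \<open>F n\<close>, the form in which it is both used
  here and verified later.\<close>

lemma maximal_inequality:
  fixes X :: "nat \<Rightarrow> 'a \<Rightarrow> real" and \<epsilon> :: "nat \<Rightarrow> real"
  assumes meas: "\<And>n. X n \<in> borel_measurable (F n)"
    and nonneg: "\<And>n \<omega>. 0 \<le> X n \<omega>"
    and int: "\<And>n. integrable M (X n)"
    and drift: "\<And>n A. A \<in> sets (F n) \<Longrightarrow>
      (\<integral>\<omega>. indicator A \<omega> * X (Suc n) \<omega> \<partial>M) \<le> (\<integral>\<omega>. indicator A \<omega> * X n \<omega> \<partial>M) + \<epsilon> n"
    and c: "c \<ge> 0"
  shows "c * prob {\<omega>\<in>space M. \<exists>k<N. c \<le> X k \<omega>} \<le> expectation (X 0) + (\<Sum>n<N. \<epsilon> n)"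
proof -
  \<comment> \<open>\<open>S n\<close> looks only at times before \<open>n\<close>, so
    \<open>S (Suc n)\<close> belongs to \<open>F n\<close> and may be inserted in
    \<open>drift\<close>.\<close>
  define S where "S = (\<lambda>n. {\<omega>\<in>space M. \<forall>k<n. X k \<omega> < c})"
  have measX: "X k \<in> borel_measurable (F n)" if "k \<le> n" for k n
    using that by (induction n rule: dec_induct) (auto intro: meas measurable_F_Suc)
  have S_F: "S (Suc n) \<in> sets (F n)" for n
  proof -
    have "{\<omega>\<in>space (F n). X k \<omega> < c} \<in> sets (F n)" if "k \<le> n" for k
      using measX[OF that] by measurable
    then have "{\<omega>\<in>space (F n). \<forall>k\<in>{..<Suc n}. X k \<omega> < c} \<in> sets (F n)"
      by (intro sets.sets_Collect_finite_All) auto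
    moreover have "{\<omega>\<in>space (F n). \<forall>k\<in>{..<Suc n}. X k \<omega> < c} = S (Suc n)"
      unfolding S_def space_F by blast
    ultimately show ?thesis
      by metis
  qed
  have S_M [measurable]: "S n \<in> sets M" for n
  proof (cases n)
    case 0
    then show ?thesis
      by (simp add: S_def)
  next
    case (Suc k)
    then show ?thesis
      using sets_F_M[OF S_F[of k]] by simp
  qed
  have X_M [measurable]: "X n \<in> borel_measurable M" for n
    using meas measurable_F_M by blast
  have intA: "integrable M (\<lambda>\<omega>. indicator A \<omega> * X n \<omega>)" if "A \<in> sets M" for A n
    using integrable_mult_indicator[OF that int] by simp
  \<comment> \<open>The process frozen at the value \<open>c\<close> once it has reached that level.
    Freezing discards the overshoot, so the expectation grows by at most
    \<open>\<epsilon> n\<close>.\<close>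
  define \<Phi> where "\<Phi> = (\<lambda>n \<omega>. indicator (S n) \<omega> * X n \<omega> + c * indicator (space M - S n) \<omega>)"
  have ind: "integrable M (\<lambda>\<omega>. c * indicator (space M - S n) \<omega>)" for n
    by (rule integrable_mult_right) (simp add: emeasure_finite less_top[symmetric])
  have int\<Phi>: "integrable M (\<Phi> n)" for n
    unfolding \<Phi>_def by (intro Bochner_Integration.integrable_add intA S_M ind)
  have "expectation (\<Phi> n) \<le> expectation (X 0) + (\<Sum>k<n. \<epsilon> k)" for n
  proof (induction n)
    case 0
    have "expectation (\<Phi> 0) = expectation (X 0)"
      by (intro Bochner_Integration.integral_cong) (auto simp: \<Phi>_def S_def)
    then show ?case
      by simp
  next
    case (Suc n)
    have "expectation (\<Phi> (Suc n)) = (\<integral>\<omega>. indicator (S (Suc n)) \<omega> * X (Suc n) \<omega> \<partial>M)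
        + (\<integral>\<omega>. c * indicator (space M - S (Suc n)) \<omega> \<partial>M)"
      unfolding \<Phi>_def by (intro Bochner_Integration.integral_add intA S_M ind)
    also have "\<dots> \<le> ((\<integral>\<omega>. indicator (S (Suc n)) \<omega> * X n \<omega> \<partial>M) + \<epsilon> n)
        + (\<integral>\<omega>. c * indicator (space M - S (Suc n)) \<omega> \<partial>M)"
      by (intro add_right_mono drift S_F)
    also have "\<dots> = (\<integral>\<omega>. indicator (S (Suc n)) \<omega> * X n \<omega> + c * indicator (space M - S (Suc n)) \<omega> \<partial>M) + \<epsilon> n"
      by (simp add: Bochner_Integration.integral_add[OF intA[OF S_M] ind])
    also have "(\<integral>\<omega>. indicator (S (Suc n)) \<omega> * X n \<omega> + c * indicator (space M - S (Suc n)) \<omega> \<partial>M)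
        \<le> expectation (\<Phi> n)"
    proof (intro integral_mono Bochner_Integration.integrable_add intA S_M ind int\<Phi>)
      fix \<omega> assume "\<omega> \<in> space M"
      have sub: "S (Suc n) \<subseteq> S n"
        by (auto simp: S_def)
      have "X n \<omega> \<ge> c" if "\<omega> \<in> S n" "\<omega> \<notin> S (Suc n)"
        using that by (auto simp: S_def less_Suc_eq)
      then show "indicator (S (Suc n)) \<omega> * X n \<omega> + c * indicator (space M - S (Suc n)) \<omega> \<le> \<Phi> n \<omega>"
        using sub \<open>\<omega> \<in> space M\<close> nonneg[of n \<omega>] c by (auto simp: \<Phi>_def indicator_def)
    qed
    finally show ?case
      using Suc by simp
  qed
  moreover have "c * prob {\<omega>\<in>space M. \<exists>k<N. c \<le> X k \<omega>} = (\<integral>\<omega>. c * indicator (space M - S N) \<omega> \<partial>M)"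
  proof -
    have "{\<omega>\<in>space M. \<exists>k<N. c \<le> X k \<omega>} = space M - S N"
      by (auto simp: S_def not_less)
    then show ?thesis
      by simp
  qed
  moreover have "(\<integral>\<omega>. c * indicator (space M - S N) \<omega> \<partial>M) \<le> expectation (\<Phi> N)"
    using nonneg by (intro integral_mono ind int\<Phi>) (auto simp: \<Phi>_def zero_le_mult_iff)
  ultimately show ?thesis
    by (metis order_trans)
qed

text \<open>The maximal inequality, uniformly in the horizon, bounds the probability of ever
  reaching the level \<open>Suc c\<close> by \<open>K / Suc c\<close>; unbounded paths lie in all
  these events.\<close>

lemma AE_bounded_almost_supermartingale:
  fixes X :: "nat \<Rightarrow> 'a \<Rightarrow> real" and \<epsilon> :: "nat \<Rightarrow> real"
  assumes meas: "\<And>n. X n \<in> borel_measurable (F n)"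
    and nonneg: "\<And>n \<omega>. 0 \<le> X n \<omega>"
    and int: "\<And>n. integrable M (X n)"
    and drift: "\<And>n A. A \<in> sets (F n) \<Longrightarrow>
      (\<integral>\<omega>. indicator A \<omega> * X (Suc n) \<omega> \<partial>M) \<le> (\<integral>\<omega>. indicator A \<omega> * X n \<omega> \<partial>M) + \<epsilon> n"
    and \<epsilon>: "\<And>N. (\<Sum>n<N. \<epsilon> n) \<le> B"
  shows "AE \<omega> in M. \<exists>C. \<forall>n. X n \<omega> \<le> C"
proof -
  have X_M [measurable]: "X n \<in> borel_measurable M" for n
    using meas measurable_F_M by blast
  define U where "U = (\<lambda>c. {\<omega>\<in>space M. \<exists>k. real (Suc c) \<le> X k \<omega>})"
  have U_M [measurable]: "U c \<in> sets M" for c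
    unfolding U_def by measurable
  define K where "K = expectation (X 0) + B"
  have le: "prob (U c) \<le> K / real (Suc c)" for c
  proof -
    define V where "V = (\<lambda>N. {\<omega>\<in>space M. \<exists>k<N. real (Suc c) \<le> X k \<omega>})"
    have "(\<lambda>N. prob (V N)) \<longlonglongrightarrow> prob (\<Union>N. V N)"
    proof (rule finite_Lim_measure_incseq)
      show "range V \<subseteq> sets M"
        unfolding V_def by (intro image_subsetI) measurable
      show "incseq V"
        by (auto simp: V_def incseq_def intro: less_le_trans)
    qed
    moreover have "(\<Union>N. V N) = U c"
      by (auto simp: V_def U_def)
    moreover have "prob (V N) \<le> K / real (Suc c)" for N
      using maximal_inequality[OF meas nonneg int drift, of "real (Suc c)" N] \<epsilon>[of N]
      by (simp add: V_def K_def field_simps)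
    ultimately show ?thesis
      by (metis LIMSEQ_le_const2)
  qed
  have "prob (\<Inter>c. U c) \<le> K / real (Suc c)" for c
    using le[of c] finite_measure_mono[of "\<Inter>c. U c" "U c"] by (auto intro: order_trans)
  moreover have "(\<lambda>c. K / real (Suc c)) \<longlonglongrightarrow> 0"
    by (rule LIMSEQ_Suc[OF lim_const_over_n])
  ultimately have "prob (\<Inter>c. U c) \<le> 0"
    by (meson LIMSEQ_le_const)
  then have "prob (\<Inter>c. U c) = 0"
    by (simp add: measure_le_0_iff)
  then have "(\<Inter>c. U c) \<in> null_sets M"
    by (intro null_setsI) (auto simp: emeasure_eq_measure)
  then show ?thesis
  proof (rule AE_I', safe)
    fix \<omega> assume \<omega>: "\<omega> \<in> space M" "\<nexists>C. \<forall>n. X n \<omega> \<le> C"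
    have "\<exists>k. real (Suc c) \<le> X k \<omega>" for c
      using \<omega>(2) by (meson linear)
    then show "\<omega> \<in> U c" for c
      using \<omega>(1) by (simp add: U_def)
  qed
qed


text \<open>In the expansion of \<open>|r * m + e * z| powr p\<close> the factor \<open>r\<close>
  only shrinks the first term, the linear term integrates to 0 over events of \<open>F n\<close>,
  and the remainders have total expectation at most \<open>3 * K * B\<close>. Thus
  \<open>|m| powr p\<close> is an almost supermartingale.\<close>

lemma AE_bounded_autoregression:
  fixes m r e z :: "nat \<Rightarrow> 'a \<Rightarrow> real" and K B p :: real
  assumes p: "1 < p" "p \<le> 2"
    and z [measurable]: "\<And>n. z n \<in> borel_measurable (F (Suc n))"
    and z_int: "\<And>n. integrable M (z n)"
    and z_centered: "\<And>n. AE \<omega> in M. real_cond_exp M (F n) (z n) \<omega> = 0"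
    and z_moment_int: "\<And>n. integrable M (\<lambda>\<omega>. \<bar>z n \<omega>\<bar> powr p)"
    and z_moment: "\<And>n. AE \<omega> in M. real_cond_exp M (F n) (\<lambda>\<omega>. \<bar>z n \<omega>\<bar> powr p) \<omega> \<le> K"
    and K: "K \<ge> 0"
    and r [measurable]: "\<And>n. r n \<in> borel_measurable (F n)"
    and r01: "\<And>n \<omega>. 0 \<le> r n \<omega> \<and> r n \<omega> \<le> 1"
    and e [measurable]: "\<And>n. e n \<in> borel_measurable (F n)"
    and e_sum: "\<And>N \<omega>. (\<Sum>n<N. \<bar>e n \<omega>\<bar> powr p) \<le> B"
    and m_0: "\<And>\<omega>. m 0 \<omega> = 0"
    and m_Suc: "\<And>n \<omega>. m (Suc n) \<omega> = r n \<omega> * m n \<omega> + e n \<omega> * z n \<omega>"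
  shows "AE \<omega> in M. \<exists>C. \<forall>n. \<bar>m n \<omega>\<bar> powr p \<le> C"
proof -
  have m_meas [measurable]: "m n \<in> borel_measurable (F n)" for n
  proof (induction n)
    case 0
    have "m 0 = (\<lambda>_. 0)"
      using m_0 by auto
    then show ?case
      by simp
  next
    case (Suc n)
    note [measurable] = measurable_F_Suc[OF Suc] measurable_F_Suc[OF r] measurable_F_Suc[OF e]
    have "m (Suc n) = (\<lambda>\<omega>. r n \<omega> * m n \<omega> + e n \<omega> * z n \<omega>)"
      using m_Suc by auto
    then show ?case
      by simp
  qed
  note [measurable] = measurable_F_M[OF m_meas] measurable_F_M[OF z] measurable_F_M[OF r] measurable_F_M[OF e]
  have B: "\<bar>e n \<omega>\<bar> powr p \<le> B" for n \<omega>
  proof -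
    have "\<bar>e n \<omega>\<bar> powr p \<le> (\<Sum>k<Suc n. \<bar>e k \<omega>\<bar> powr p)"
      by (rule member_le_sum) auto
    also have "\<dots> \<le> B"
      by (rule e_sum)
    finally show ?thesis .
  qed
  have ez: "\<bar>e n \<omega> * z n \<omega>\<bar> powr p \<le> B * \<bar>z n \<omega>\<bar> powr p" for n \<omega>
    using B by (simp add: abs_mult powr_mult mult_right_mono)
  have rm: "\<bar>r n \<omega> * m n \<omega>\<bar> powr p \<le> \<bar>m n \<omega>\<bar> powr p" for n \<omega>
    using r01[of n \<omega>] p by (intro powr_mono2) (auto simp: abs_mult mult_left_le_one_le)
  have X_int: "integrable M (\<lambda>\<omega>. \<bar>m n \<omega>\<bar> powr p)" for n
  proof (induction n)
    case 0
    then show ?case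
      by (simp add: m_0)
  next
    case (Suc n)
    show ?case
    proof (rule Bochner_Integration.integrable_bound)
      show "integrable M (\<lambda>\<omega>. 2 powr p * (\<bar>m n \<omega>\<bar> powr p + B * \<bar>z n \<omega>\<bar> powr p))"
        by (intro integrable_mult_right Bochner_Integration.integrable_add Suc z_moment_int)
      have "\<bar>m (Suc n) \<omega>\<bar> powr p \<le> 2 powr p * (\<bar>m n \<omega>\<bar> powr p + B * \<bar>z n \<omega>\<bar> powr p)" for \<omega>
        using abs_add_powr_le[of p "r n \<omega> * m n \<omega>" "e n \<omega> * z n \<omega>"] p
        by (intro order_trans[OF _ mult_left_mono[OF add_mono[OF rm ez]]]) (auto simp: m_Suc)
      then show "AE \<omega> in M. norm (\<bar>m (Suc n) \<omega>\<bar> powr p)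
          \<le> norm (2 powr p * (\<bar>m n \<omega>\<bar> powr p + B * \<bar>z n \<omega>\<bar> powr p))"
        by (intro AE_I2) (smt (verit) powr_ge_zero real_norm_def)
    qed measurable
  qed
  define \<epsilon> where "\<epsilon> = (\<lambda>n. 3 * K * expectation (\<lambda>\<omega>. \<bar>e n \<omega>\<bar> powr p))"
  have e_int: "integrable M (\<lambda>\<omega>. \<bar>e n \<omega>\<bar> powr p)" for n
    using B by (intro integrable_const_bound[of _ B]) auto
  have \<epsilon>_sum: "(\<Sum>n<N. \<epsilon> n) \<le> 3 * K * B" for N
  proof -
    have "(\<Sum>n<N. expectation (\<lambda>\<omega>. \<bar>e n \<omega>\<bar> powr p)) = expectation (\<lambda>\<omega>. \<Sum>n<N. \<bar>e n \<omega>\<bar> powr p)"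
      by (intro Bochner_Integration.integral_sum[symmetric] e_int)
    also have "\<dots> \<le> expectation (\<lambda>\<omega>. B)"
      using e_sum by (intro integral_mono Bochner_Integration.integrable_sum e_int) auto
    finally show ?thesis
      using K by (simp add: \<epsilon>_def prob_space mult_left_mono flip: sum_distrib_left)
  qed
  have drift: "(\<integral>\<omega>. indicator A \<omega> * \<bar>m (Suc n) \<omega>\<bar> powr p \<partial>M)
      \<le> (\<integral>\<omega>. indicator A \<omega> * \<bar>m n \<omega>\<bar> powr p \<partial>M) + \<epsilon> n" if A: "A \<in> sets (F n)" for n A
  proof -
    interpret Fn: sigma_finite_subalgebra M "F n"
      by (rule sigma_finite_F)
    have [measurable]: "A \<in> sets M"
      using A by (rule sets_F_M)
    \<comment> \<open>The \<open>F n\<close>-measurable coefficient of \<open>z n\<close> in the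
      expansion, restricted to \<open>A\<close>. Once \<open>g * z n\<close> is integrable, centring
      of \<open>z n\<close> makes its integral vanish.\<close>
    define g where "g = (\<lambda>\<omega>. indicator A \<omega> * (p * (sgn (r n \<omega> * m n \<omega>) * \<bar>r n \<omega> * m n \<omega>\<bar> powr (p - 1)) * e n \<omega>))"
    have g_meas: "g \<in> borel_measurable (F n)"
      unfolding g_def using A by measurable
    note [measurable] = measurable_F_M[OF g_meas]
    have gz_int: "integrable M (\<lambda>\<omega>. g \<omega> * z n \<omega>)"
    proof (rule Bochner_Integration.integrable_bound)
      show "integrable M (\<lambda>\<omega>. p * (\<bar>m n \<omega>\<bar> powr p + B * \<bar>z n \<omega>\<bar> powr p))"
        by (intro integrable_mult_right Bochner_Integration.integrable_add X_int z_moment_int)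
      have "\<bar>g \<omega> * z n \<omega>\<bar> \<le> p * (\<bar>m n \<omega>\<bar> powr p + B * \<bar>z n \<omega>\<bar> powr p)" for \<omega>
      proof -
        have "\<bar>g \<omega> * z n \<omega>\<bar> \<le> p * (\<bar>r n \<omega> * m n \<omega>\<bar> powr (p - 1) * \<bar>e n \<omega> * z n \<omega>\<bar>)"
          using p by (auto simp: g_def abs_mult indicator_def abs_sgn_eq)
        also have "\<dots> \<le> p * (\<bar>r n \<omega> * m n \<omega>\<bar> powr p + \<bar>e n \<omega> * z n \<omega>\<bar> powr p)"
          using p by (intro mult_left_mono powr_mult_le_powr_add) auto
        also have "\<dots> \<le> p * (\<bar>m n \<omega>\<bar> powr p + B * \<bar>z n \<omega>\<bar> powr p)"
          using p by (intro mult_left_mono add_mono rm ez) auto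
        finally show ?thesis .
      qed
      then show "AE \<omega> in M. norm (g \<omega> * z n \<omega>) \<le> norm (p * (\<bar>m n \<omega>\<bar> powr p + B * \<bar>z n \<omega>\<bar> powr p))"
        by (intro AE_I2) (smt (verit) real_norm_def)
    qed measurable
    have "(\<integral>\<omega>. g \<omega> * z n \<omega> \<partial>M) = (\<integral>\<omega>. g \<omega> * real_cond_exp M (F n) (z n) \<omega> \<partial>M)"
      by (rule Fn.real_cond_exp_intg(2)[OF gz_int g_meas, symmetric]) measurable
    also have "\<dots> = (\<integral>\<omega>. 0 \<partial>M)"
      using z_centered[of n] by (intro integral_cong_AE) auto
    finally have cross: "(\<integral>\<omega>. g \<omega> * z n \<omega> \<partial>M) = 0"
      by simp
    have ez_int: "integrable M (\<lambda>\<omega>. \<bar>e n \<omega>\<bar> powr p * \<bar>z n \<omega>\<bar> powr p)"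
      using B by (intro Bochner_Integration.integrable_bound[OF integrable_mult_right[OF z_moment_int, of B]])
        (auto simp: abs_mult intro!: mult_right_mono order_trans[OF B] AE_I2)
    have "(\<integral>\<omega>. \<bar>e n \<omega>\<bar> powr p * \<bar>z n \<omega>\<bar> powr p \<partial>M)
        = (\<integral>\<omega>. \<bar>e n \<omega>\<bar> powr p * real_cond_exp M (F n) (\<lambda>\<omega>. \<bar>z n \<omega>\<bar> powr p) \<omega> \<partial>M)"
      by (rule Fn.real_cond_exp_intg(2)[OF ez_int, symmetric]) measurable
    also have "\<dots> \<le> (\<integral>\<omega>. \<bar>e n \<omega>\<bar> powr p * K \<partial>M)"
    proof (intro integral_mono_AE Fn.real_cond_exp_intg(1)[OF ez_int] integrable_mult_left e_int)
      show "AE \<omega> in M. \<bar>e n \<omega>\<bar> powr p * real_cond_exp M (F n) (\<lambda>\<omega>. \<bar>z n \<omega>\<bar> powr p) \<omega> \<le> \<bar>e n \<omega>\<bar> powr p * K"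
        using z_moment[of n] by eventually_elim (simp add: mult_left_mono)
    qed measurable
    finally have moment: "3 * (\<integral>\<omega>. \<bar>e n \<omega>\<bar> powr p * \<bar>z n \<omega>\<bar> powr p \<partial>M) \<le> \<epsilon> n"
      by (simp add: \<epsilon>_def mult_ac)
    have A_int: "integrable M (\<lambda>\<omega>. indicator A \<omega> * \<bar>m n \<omega>\<bar> powr p)" for n
      using integrable_mult_indicator[OF \<open>A \<in> sets M\<close> X_int] by simp
    have "(\<integral>\<omega>. indicator A \<omega> * \<bar>m (Suc n) \<omega>\<bar> powr p \<partial>M)
        \<le> (\<integral>\<omega>. (indicator A \<omega> * \<bar>m n \<omega>\<bar> powr p + g \<omega> * z n \<omega>) + 3 * (\<bar>e n \<omega>\<bar> powr p * \<bar>z n \<omega>\<bar> powr p) \<partial>M)"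
    proof (intro integral_mono A_int Bochner_Integration.integrable_add gz_int integrable_mult_right ez_int)
      fix \<omega>
      show "indicator A \<omega> * \<bar>m (Suc n) \<omega>\<bar> powr p
        \<le> (indicator A \<omega> * \<bar>m n \<omega>\<bar> powr p + g \<omega> * z n \<omega>) + 3 * (\<bar>e n \<omega>\<bar> powr p * \<bar>z n \<omega>\<bar> powr p)"
      proof (cases "\<omega> \<in> A")
        case True
        then show ?thesis
          using abs_add_powr_le_taylor[OF p, of "r n \<omega> * m n \<omega>" "e n \<omega> * z n \<omega>"] rm[of n \<omega>]
          by (simp add: g_def m_Suc abs_mult powr_mult mult_ac)
      next
        case False
        then show ?thesis
          by (simp add: g_def)
      qed
    qed
    also have "\<dots> = (\<integral>\<omega>. indicator A \<omega> * \<bar>m n \<omega>\<bar> powr p \<partial>M)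
        + 3 * (\<integral>\<omega>. \<bar>e n \<omega>\<bar> powr p * \<bar>z n \<omega>\<bar> powr p \<partial>M)"
      using A_int gz_int ez_int cross by simp
    finally show ?thesis
      using moment by linarith
  qed
  show ?thesis
  proof (rule AE_bounded_almost_supermartingale[OF _ _ X_int drift \<epsilon>_sum])
    show "(\<lambda>\<omega>. \<bar>m n \<omega>\<bar> powr p) \<in> borel_measurable (F n)" for n
      by measurable
  qed auto
qed

text \<open>The sum divided by \<open>T powr (1 / p)\<close> is an autoregression with factor
  \<open>S n / S (Suc n)\<close>. Measurability of \<open>T (Suc n)\<close> at time \<open>n\<close>
  keeps this factor and the new weight adapted.\<close>

lemma AE_weighted_martingale_bound:
  fixes c T z :: "nat \<Rightarrow> 'a \<Rightarrow> real" and K B p :: real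
  assumes p: "1 < p" "p \<le> 2"
    and z: "\<And>n. z n \<in> borel_measurable (F (Suc n))"
    and z_int: "\<And>n. integrable M (z n)"
    and z_centered: "\<And>n. AE \<omega> in M. real_cond_exp M (F n) (z n) \<omega> = 0"
    and z_moment_int: "\<And>n. integrable M (\<lambda>\<omega>. \<bar>z n \<omega>\<bar> powr p)"
    and z_moment: "\<And>n. AE \<omega> in M. real_cond_exp M (F n) (\<lambda>\<omega>. \<bar>z n \<omega>\<bar> powr p) \<omega> \<le> K"
    and K: "K \<ge> 0"
    and c [measurable]: "\<And>n. c n \<in> borel_measurable (F n)"
    and T [measurable]: "\<And>n. T n \<in> borel_measurable (F n)" "\<And>n. T (Suc n) \<in> borel_measurable (F n)"
    and T_pos: "\<And>n \<omega>. 0 < T n \<omega>" and T_mono: "\<And>n \<omega>. T n \<omega> \<le> T (Suc n) \<omega>"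
    and c_sum: "\<And>N \<omega>. (\<Sum>n<N. \<bar>c n \<omega>\<bar> powr p / T (Suc n) \<omega>) \<le> B"
  shows "AE \<omega> in M. \<exists>C. \<forall>N. \<bar>\<Sum>n<N. c n \<omega> * z n \<omega>\<bar> powr p \<le> C * T N \<omega>"
proof -
  define S where "S = (\<lambda>n \<omega>. T n \<omega> powr (1 / p))"
  have S_pos: "S n \<omega> > 0" for n \<omega>
    using T_pos[of n \<omega>] by (simp add: S_def)
  have S_powr: "S n \<omega> powr p = T n \<omega>" for n \<omega>
    using T_pos[of n \<omega>] p by (simp add: S_def powr_powr)
  have S_mono: "S n \<omega> \<le> S (Suc n) \<omega>" for n \<omega>
    unfolding S_def using T_pos[of n \<omega>] T_mono p by (intro powr_mono2) auto
  have [measurable]: "S n \<in> borel_measurable (F n)" "S (Suc n) \<in> borel_measurable (F n)" for n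
    unfolding S_def by measurable
  have "AE \<omega> in M. \<exists>C. \<forall>N. \<bar>(\<Sum>n<N. c n \<omega> * z n \<omega>) / S N \<omega>\<bar> powr p \<le> C"
  proof (rule AE_bounded_autoregression[OF p z z_int z_centered z_moment_int z_moment K])
    show "(\<lambda>\<omega>. S n \<omega> / S (Suc n) \<omega>) \<in> borel_measurable (F n)"
      "(\<lambda>\<omega>. c n \<omega> / S (Suc n) \<omega>) \<in> borel_measurable (F n)" for n
      by measurable
    show "0 \<le> S n \<omega> / S (Suc n) \<omega> \<and> S n \<omega> / S (Suc n) \<omega> \<le> 1" for n \<omega>
      using S_pos[of n \<omega>] S_pos[of "Suc n" \<omega>] S_mono by simp
    show "(\<Sum>n<N. \<bar>c n \<omega> / S (Suc n) \<omega>\<bar> powr p) \<le> B" for N \<omega>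
    proof -
      have "\<bar>c n \<omega> / S (Suc n) \<omega>\<bar> powr p = \<bar>c n \<omega>\<bar> powr p / T (Suc n) \<omega>" for n
        using S_pos[of "Suc n" \<omega>] by (simp add: powr_divide S_powr)
      then show ?thesis
        using c_sum by simp
    qed
    show "(\<Sum>n<Suc n. c n \<omega> * z n \<omega>) / S (Suc n) \<omega> =
      S n \<omega> / S (Suc n) \<omega> * ((\<Sum>n<n. c n \<omega> * z n \<omega>) / S n \<omega>) + c n \<omega> / S (Suc n) \<omega> * z n \<omega>" for n \<omega>
      using S_pos[of n \<omega>] by (simp add: add_divide_distrib)
  qed simp
  then show ?thesis
  proof eventually_elim
    case (elim \<omega>)
    have "\<bar>(\<Sum>n<N. c n \<omega> * z n \<omega>) / S N \<omega>\<bar> powr p = \<bar>\<Sum>n<N. c n \<omega> * z n \<omega>\<bar> powr p / T N \<omega>" for N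
      using S_pos[of N \<omega>] by (simp add: powr_divide S_powr)
    with elim show ?case
      using T_pos by (simp add: divide_le_eq)
  qed
qed

end

subsection \<open>The self-normalized bound of Lai and Wei\<close>

lemma borel_measurable_ridge_inv:
  fixes x :: "nat \<Rightarrow> 'a \<Rightarrow> 'b::euclidean_space"
  assumes "\<And>k. k < n \<Longrightarrow> x k \<in> borel_measurable N" "f \<in> borel_measurable N"
  shows "(\<lambda>\<omega>. ridge_inv (\<lambda>k. x k \<omega>) n (f \<omega>)) \<in> borel_measurable N"
  using assms
proof (induction n arbitrary: f)
  case (Suc n)
  have [measurable]: "x n \<in> borel_measurable N" "f \<in> borel_measurable N"
    using Suc.prems by auto
  have [measurable]: "(\<lambda>\<omega>. ridge_inv (\<lambda>k. x k \<omega>) n (x n \<omega>)) \<in> borel_measurable N"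
    "(\<lambda>\<omega>. ridge_inv (\<lambda>k. x k \<omega>) n (f \<omega>)) \<in> borel_measurable N"
    using Suc.prems by (auto intro: Suc.IH)
  show ?case
    by simp
qed simp

context filtered_prob_space
begin

lemma measurable_F_mono: "f \<in> measurable (F k) N \<Longrightarrow> k \<le> n \<Longrightarrow> f \<in> measurable (F n) N"
  by (rotate_tac, induction n rule: dec_induct) (auto intro: measurable_F_Suc)

lemma real_cond_exp_affine_bound:
  assumes f: "integrable M f" and g: "integrable M g"
    and le: "AE \<omega> in M. g \<omega> \<le> a * f \<omega> + b" and a: "a \<ge> 0"
    and K: "AE \<omega> in M. real_cond_exp M (F n) f \<omega> \<le> K"
  shows "AE \<omega> in M. real_cond_exp M (F n) g \<omega> \<le> a * K + b"
proof -
  interpret Fn: sigma_finite_subalgebra M "F n"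
    by (rule sigma_finite_F)
  have "AE \<omega> in M. real_cond_exp M (F n) g \<omega> \<le> real_cond_exp M (F n) (\<lambda>\<omega>. a * f \<omega> + b) \<omega>"
    using f g le by (intro Fn.real_cond_exp_mono) auto
  moreover have "AE \<omega> in M. real_cond_exp M (F n) (\<lambda>\<omega>. a * f \<omega> + b) \<omega>
      = real_cond_exp M (F n) (\<lambda>\<omega>. a * f \<omega>) \<omega> + real_cond_exp M (F n) (\<lambda>\<omega>. b) \<omega>"
    using f by (intro Fn.real_cond_exp_add) auto
  moreover have "AE \<omega> in M. real_cond_exp M (F n) (\<lambda>\<omega>. a * f \<omega>) \<omega> = a * real_cond_exp M (F n) f \<omega>"
    using f by (rule Fn.real_cond_exp_cmult)
  moreover have "AE \<omega> in M. real_cond_exp M (F n) (\<lambda>\<omega>. b) \<omega> = b"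
    by (intro Fn.real_cond_exp_F_meas) auto
  ultimately show ?thesis
    using K
  proof eventually_elim
    case (elim \<omega>)
    then have "a * real_cond_exp M (F n) f \<omega> \<le> a * K"
      using a by (intro mult_left_mono)
    with elim show ?case
      by simp
  qed
qed

text \<open>The self-normalized score grows by a martingale with quadratic variation of order \<open>H\<close>,
  minus \<open>H\<close>, plus a weighted sum of squared noises of order \<open>L\<close>. Normalizing the square of the
  martingale by \<open>H powr (3/2)\<close> instead of \<open>H\<^sup>2\<close> shows that it is \<open>o(H) + O(1)\<close>, so that
  \<open>- H\<close> absorbs it.\<close>

lemma AE_self_normalized_bound:
  fixes x :: "nat \<Rightarrow> 'a \<Rightarrow> 'b::euclidean_space" and v :: "nat \<Rightarrow> 'a \<Rightarrow> real" and p K :: real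
  assumes p: "1 < p" "p \<le> 2"
    and x: "\<And>n. x n \<in> borel_measurable (F n)"
    and v: "\<And>n. v n \<in> borel_measurable (F (Suc n))"
    and v_int: "\<And>n. integrable M (v n)"
    and v_centered: "\<And>n. AE \<omega> in M. real_cond_exp M (F n) (v n) \<omega> = 0"
    and v_moment_int: "\<And>n. integrable M (\<lambda>\<omega>. \<bar>v n \<omega>\<bar> powr (2 * p))"
    and v_moment: "\<And>n. AE \<omega> in M. real_cond_exp M (F n) (\<lambda>\<omega>. \<bar>v n \<omega>\<bar> powr (2 * p)) \<omega> \<le> K"
    and K: "K \<ge> 0"
  shows "AE \<omega> in M. \<exists>C. \<forall>N. self_normalized (\<lambda>k. x k \<omega>) (\<lambda>k. v k \<omega>) N
    \<le> C * (1 + log_volume (\<lambda>k. x k \<omega>) N)"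
proof -

  \<comment> \<open>Moments of the noise and of its centred square\<close>
  have [measurable]: "v n \<in> borel_measurable M" for n
    using measurable_F_M[OF v] .
  define s where "s = (\<lambda>n. real_cond_exp M (F n) (\<lambda>\<omega>. (v n \<omega>)\<^sup>2))"
  \<comment> \<open>Its \<open>p\<close>-th absolute moment is controlled by the
    \<open>2 * p\<close>-th moment of \<open>v n\<close>; for \<open>p < 2\<close> no second moment
    is at hand.\<close>
  define z where "z = (\<lambda>n \<omega>. (v n \<omega>)\<^sup>2 - s n \<omega>)"
  have sq_le: "t\<^sup>2 \<le> 1 * \<bar>t\<bar> powr (2 * p) + 1" for t :: real
  proof (cases "\<bar>t\<bar> \<le> 1")
    case True
    then have "t\<^sup>2 \<le> 1"
      by (simp add: abs_square_le_1)
    then show ?thesis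
      by (simp add: add_increasing)
  next
    case False
    then have "\<bar>t\<bar> powr 2 \<le> \<bar>t\<bar> powr (2 * p)"
      using p by (intro powr_mono) auto
    then show ?thesis
      using False by (simp add: powr_numeral)
  qed
  have sq_int: "integrable M (\<lambda>\<omega>. (v n \<omega>)\<^sup>2)" for n
  proof (rule Bochner_Integration.integrable_bound)
    show "integrable M (\<lambda>\<omega>. 1 * \<bar>v n \<omega>\<bar> powr (2 * p) + 1)"
      by (intro Bochner_Integration.integrable_add integrable_mult_right v_moment_int) simp
    show "AE \<omega> in M. norm ((v n \<omega>)\<^sup>2) \<le> norm (1 * \<bar>v n \<omega>\<bar> powr (2 * p) + 1)"
      using sq_le by (intro AE_I2) (simp add: add_nonneg_nonneg)
  qed measurable
  have s_le: "AE \<omega> in M. s n \<omega> \<le> 1 * K + 1" for n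
    unfolding s_def using sq_le
    by (intro real_cond_exp_affine_bound[OF v_moment_int sq_int _ _ v_moment] AE_I2) auto
  interpret Fn: sigma_finite_subalgebra M "F n" for n
    by (rule sigma_finite_F)
  have s_nonneg: "AE \<omega> in M. 0 \<le> s n \<omega>" for n
    unfolding s_def by (intro Fn.real_cond_exp_pos) auto
  have s_meas: "s n \<in> borel_measurable (F n)" for n
    unfolding s_def by measurable
  have s_int: "integrable M (s n)" for n
    unfolding s_def by (rule Fn.real_cond_exp_int(1)[OF sq_int])
  note [measurable] = measurable_F_M[OF s_meas]
  have z_meas: "z n \<in> borel_measurable (F (Suc n))" for n
    using v[of n] measurable_F_Suc[OF s_meas[of n]] unfolding z_def by measurable
  note [measurable] = measurable_F_M[OF z_meas]
  have z_int: "integrable M (z n)" for n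
    unfolding z_def by (intro Bochner_Integration.integrable_diff sq_int s_int)
  have z_centered: "AE \<omega> in M. real_cond_exp M (F n) (z n) \<omega> = 0" for n
  proof -
    have "AE \<omega> in M. real_cond_exp M (F n) (z n) \<omega> =
        real_cond_exp M (F n) (\<lambda>\<omega>. (v n \<omega>)\<^sup>2) \<omega> - real_cond_exp M (F n) (s n) \<omega>"
      unfolding z_def by (intro Fn.real_cond_exp_diff sq_int s_int)
    moreover have "AE \<omega> in M. real_cond_exp M (F n) (s n) \<omega> = s n \<omega>"
      by (intro Fn.real_cond_exp_F_meas s_int s_meas)
    ultimately show ?thesis
      by eventually_elim (simp add: s_def)
  qed
  have z_powr: "AE \<omega> in M. \<bar>z n \<omega>\<bar> powr p \<le> 2 powr p * \<bar>v n \<omega>\<bar> powr (2 * p) + 2 powr p * (K + 1) powr p" for n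
    using s_le[of n] s_nonneg[of n]
  proof eventually_elim
    case (elim \<omega>)
    have "\<bar>z n \<omega>\<bar> powr p \<le> 2 powr p * (\<bar>(v n \<omega>)\<^sup>2\<bar> powr p + \<bar>- s n \<omega>\<bar> powr p)"
      using abs_add_powr_le[of p "(v n \<omega>)\<^sup>2" "- s n \<omega>"] p by (simp add: z_def)
    also have "\<bar>(v n \<omega>)\<^sup>2\<bar> powr p = \<bar>v n \<omega>\<bar> powr (2 * p)"
      using powr_powr[of "\<bar>v n \<omega>\<bar>" 2 p] by simp
    also have "\<bar>- s n \<omega>\<bar> powr p \<le> (K + 1) powr p"
      using elim p by (intro powr_mono2) auto
    finally show ?case
      by (simp add: distrib_left)
  qed
  have z_moment_int: "integrable M (\<lambda>\<omega>. \<bar>z n \<omega>\<bar> powr p)" for n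
  proof (rule Bochner_Integration.integrable_bound)
    show "integrable M (\<lambda>\<omega>. 2 powr p * \<bar>v n \<omega>\<bar> powr (2 * p) + 2 powr p * (K + 1) powr p)"
      by (intro Bochner_Integration.integrable_add integrable_mult_right v_moment_int) simp
    show "AE \<omega> in M. norm (\<bar>z n \<omega>\<bar> powr p) \<le> norm (2 powr p * \<bar>v n \<omega>\<bar> powr (2 * p) + 2 powr p * (K + 1) powr p)"
      using z_powr[of n] by eventually_elim simp
  qed measurable
  have z_moment: "AE \<omega> in M. real_cond_exp M (F n) (\<lambda>\<omega>. \<bar>z n \<omega>\<bar> powr p) \<omega>
      \<le> 2 powr p * K + 2 powr p * (K + 1) powr p" for n
    by (intro real_cond_exp_affine_bound[OF v_moment_int z_moment_int z_powr _ v_moment]) simp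
  have v2_int: "integrable M (\<lambda>\<omega>. \<bar>v n \<omega>\<bar> powr 2)" for n
    using sq_int[of n] by simp
  have v2_moment: "AE \<omega> in M. real_cond_exp M (F n) (\<lambda>\<omega>. \<bar>v n \<omega>\<bar> powr 2) \<omega> \<le> 1 * K + 1" for n
    using s_le[of n] by (simp add: s_def)

  \<comment> \<open>Predictable coefficients and normalizers of the recursion\<close>
  define X where "X = (\<lambda>\<omega> k. x k \<omega>)"
  define V where "V = (\<lambda>\<omega> k. v k \<omega>)"
  define b where "b = (\<lambda>n \<omega>. leverage (X \<omega>) n)"
  define g where "g = (\<lambda>n \<omega>. innovation (X \<omega>) (V \<omega>) n)"
  define h where "h = (\<lambda>n \<omega>. (g n \<omega>)\<^sup>2 / (1 + b n \<omega>))"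
  define a where "a = (\<lambda>n \<omega>. b n \<omega> / (1 + b n \<omega>))"
  \<comment> \<open>\<open>H\<close> accumulates the negative drift. Like \<open>L\<close>, it
    starts at 1 because \<open>sum_increments_powr_le\<close> requires values of at least 1.\<close>
  define H where "H = (\<lambda>n \<omega>. 1 + (\<Sum>k<n. h k \<omega>))"
  define L where "L = (\<lambda>n \<omega>. 1 + log_volume (X \<omega>) n)"
  have b_nonneg: "0 \<le> b n \<omega>" for n \<omega>
    by (simp add: b_def leverage_nonneg)
  have x_meas: "x k \<in> borel_measurable (F n)" if "k \<le> n" for k n
    using measurable_F_mono[OF x that] .
  have b_meas: "b n \<in> borel_measurable (F n)" for n
    unfolding b_def leverage_def X_def
    by (intro borel_measurable_inner x_meas borel_measurable_ridge_inv) auto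
  have g_meas: "g n \<in> borel_measurable (F n)" for n
    unfolding g_def innovation_def score_def X_def V_def
    by (intro borel_measurable_inner x_meas borel_measurable_ridge_inv borel_measurable_sum
        borel_measurable_scaleR measurable_F_mono[OF v]) auto
  have h_meas: "h n \<in> borel_measurable (F n)" for n
    using b_meas[of n] g_meas[of n] unfolding h_def by measurable
  \<comment> \<open>The leverage and \<open>h n\<close> are known at time \<open>n\<close>, so
    \<open>H (Suc n)\<close> and \<open>L (Suc n)\<close> are already \<open>F n\<close>-measurable,
    as a normalizer must be.\<close>
  have H_meas: "H n \<in> borel_measurable (F m)" if "n \<le> Suc m" for n m
    unfolding H_def using that
    by (intro borel_measurable_add borel_measurable_const borel_measurable_sum measurable_F_mono[OF h_meas]) auto
  have L_meas: "L n \<in> borel_measurable (F m)" if "n \<le> Suc m" for n m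
  proof -
    have "L n = (\<lambda>\<omega>. 1 + (\<Sum>k<n. ln (1 + b k \<omega>)))"
      by (simp add: L_def log_volume_def b_def)
    then show ?thesis
      using that by (auto intro!: borel_measurable_add borel_measurable_const borel_measurable_sum borel_measurable_ln
        measurable_F_mono[OF b_meas])
  qed
  have h_nonneg: "0 \<le> h n \<omega>" for n \<omega>
    using b_nonneg by (simp add: h_def)
  have H_ge: "1 \<le> H n \<omega>" for n \<omega>
    using h_nonneg by (simp add: H_def sum_nonneg)
  have H_Suc: "H (Suc n) \<omega> - H n \<omega> = h n \<omega>" for n \<omega>
    by (simp add: H_def)
  have H_mono: "H n \<omega> \<le> H (Suc n) \<omega>" for n \<omega>
    using H_Suc h_nonneg by (simp add: H_def)
  have a01: "0 \<le> a n \<omega>" "a n \<omega> \<le> 1" for n \<omega>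
    using b_nonneg[of n \<omega>] by (simp_all add: a_def divide_le_eq_1 add_pos_nonneg)
  have L_ge: "1 \<le> L n \<omega>" for n \<omega>
    by (simp add: L_def log_volume_nonneg)
  have a_le: "a n \<omega> \<le> L (Suc n) \<omega> - L n \<omega>" for n \<omega>
    by (simp add: a_def b_def L_def log_volume_Suc leverage_ratio_le_ln)
  have L_mono: "L n \<omega> \<le> L (Suc n) \<omega>" for n \<omega>
    using a_le[of n \<omega>] a01(1)[of n \<omega>] by simp

  \<comment> \<open>The two normalized martingales\<close>
  have M1: "AE \<omega> in M. \<exists>C. \<forall>N. \<bar>\<Sum>n<N. (2 * g n \<omega> / (1 + b n \<omega>)) * v n \<omega>\<bar> powr 2 \<le> C * H N \<omega> powr (3/2)"
  proof (rule AE_weighted_martingale_bound[OF _ _ v v_int v_centered v2_int v2_moment])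
    show "(\<lambda>\<omega>. 2 * g n \<omega> / (1 + b n \<omega>)) \<in> borel_measurable (F n)" for n
      using b_meas[of n] g_meas[of n] by measurable
    show "(\<lambda>\<omega>. H n \<omega> powr (3/2)) \<in> borel_measurable (F n)" "(\<lambda>\<omega>. H (Suc n) \<omega> powr (3/2)) \<in> borel_measurable (F n)" for n
      using H_meas[of n n] H_meas[of "Suc n" n] by measurable
    show "0 < H n \<omega> powr (3/2)" "H n \<omega> powr (3/2) \<le> H (Suc n) \<omega> powr (3/2)" for n \<omega>
      using H_ge[of n \<omega>] H_mono[of n \<omega>] by (auto intro: powr_mono2)
    \<comment> \<open>As \<open>1 / (1 + b) <= 1\<close>, the squared coefficients are at most 4
      times the increments of \<open>H\<close>; with exponent 3/2 the sum is at most
      \<open>4 / (3/2 - 1) = 8\<close>.\<close>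
    show "(\<Sum>n<N. \<bar>2 * g n \<omega> / (1 + b n \<omega>)\<bar> powr 2 / H (Suc n) \<omega> powr (3/2)) \<le> 8" for N \<omega>
    proof -
      have "\<bar>2 * g n \<omega> / (1 + b n \<omega>)\<bar> powr 2 \<le> 4 * (H (Suc n) \<omega> - H n \<omega>)" for n
      proof -
        have "(2 * g n \<omega> / (1 + b n \<omega>))\<^sup>2 = 4 * (g n \<omega>)\<^sup>2 / ((1 + b n \<omega>) * (1 + b n \<omega>))"
          by (simp add: power2_eq_square)
        also have "\<dots> \<le> 4 * (g n \<omega>)\<^sup>2 / (1 + b n \<omega>)"
          using b_nonneg[of n \<omega>] by (intro divide_left_mono) auto
        finally have "(2 * g n \<omega> / (1 + b n \<omega>))\<^sup>2 \<le> 4 * (H (Suc n) \<omega> - H n \<omega>)"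
          by (simp add: H_Suc h_def)
        moreover have "\<bar>t\<bar> powr 2 = t\<^sup>2" for t :: real
          by simp
        ultimately show ?thesis
          by metis
      qed
      then have "(\<Sum>n<N. \<bar>2 * g n \<omega> / (1 + b n \<omega>)\<bar> powr 2 / H (Suc n) \<omega> powr (3/2))
          \<le> (\<Sum>n<N. 4 * ((H (Suc n) \<omega> - H n \<omega>) / H (Suc n) \<omega> powr (3/2)))"
        by (intro sum_mono) (simp add: divide_right_mono)
      also have "\<dots> \<le> 4 * (1 / (3/2 - 1))"
        unfolding sum_distrib_left[symmetric] using H_ge H_mono
        by (intro mult_left_mono sum_increments_powr_le) auto
      finally show ?thesis
        by simp
    qed
  qed (use K in auto)
  have M2: "AE \<omega> in M. \<exists>C. \<forall>N. \<bar>\<Sum>n<N. a n \<omega> * z n \<omega>\<bar> powr p \<le> C * L N \<omega> powr p"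
  proof (rule AE_weighted_martingale_bound[OF p z_meas z_int z_centered z_moment_int z_moment])
    show "a n \<in> borel_measurable (F n)" for n
      using b_meas[of n] unfolding a_def by measurable
    show "(\<lambda>\<omega>. L n \<omega> powr p) \<in> borel_measurable (F n)" "(\<lambda>\<omega>. L (Suc n) \<omega> powr p) \<in> borel_measurable (F n)" for n
      using L_meas[of n n] L_meas[of "Suc n" n] by measurable
    show "0 < L n \<omega> powr p" "L n \<omega> powr p \<le> L (Suc n) \<omega> powr p" for n \<omega>
      using L_ge[of n \<omega>] L_mono[of n \<omega>] p by (auto intro: powr_mono2)
    \<comment> \<open>Since \<open>a\<close> lies in [0,1] and \<open>p > 1\<close>,
      \<open>a powr p <= a\<close>, which is at most an increment of \<open>L\<close>. The
      normalizer \<open>L powr p\<close> yields a bound linear in \<open>L\<close>.\<close>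
    show "(\<Sum>n<N. \<bar>a n \<omega>\<bar> powr p / L (Suc n) \<omega> powr p) \<le> 1 / (p - 1)" for N \<omega>
    proof -
      have "\<bar>a n \<omega>\<bar> powr p \<le> L (Suc n) \<omega> - L n \<omega>" for n
      proof -
        have "\<bar>a n \<omega>\<bar> powr p \<le> a n \<omega> powr 1"
          using powr_mono'[of 1 p "a n \<omega>"] a01[of n \<omega>] p by simp
        then show ?thesis
          using a_le[of n \<omega>] a01[of n \<omega>] by simp
      qed
      then have "(\<Sum>n<N. \<bar>a n \<omega>\<bar> powr p / L (Suc n) \<omega> powr p)
          \<le> (\<Sum>n<N. (L (Suc n) \<omega> - L n \<omega>) / L (Suc n) \<omega> powr p)"
        by (intro sum_mono divide_right_mono) auto
      also have "\<dots> \<le> 1 / (p - 1)"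
        using p L_ge L_mono by (intro sum_increments_powr_le) auto
      finally show ?thesis .
    qed
  qed (use K in auto)

  \<comment> \<open>Combination on a single path\<close>
  have "AE \<omega> in M. \<forall>n. s n \<omega> \<le> K + 1"
    using s_le by (simp add: AE_all_countable)
  with M1 M2 show ?thesis
  proof eventually_elim
    case (elim \<omega>)
    define M1 where "M1 = (\<lambda>N. \<Sum>n<N. (2 * g n \<omega> / (1 + b n \<omega>)) * v n \<omega>)"
    define M2 where "M2 = (\<lambda>N. \<Sum>n<N. a n \<omega> * z n \<omega>)"
    obtain C1 where "\<And>N. \<bar>M1 N\<bar> powr 2 \<le> C1 * H N \<omega> powr (3/2)"
      using elim(1) by (auto simp: M1_def)
    then have M1_sq: "(M1 N)\<^sup>2 \<le> C1 * H N \<omega> powr (3/2)" for N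
      by simp
    obtain C2 where C2: "\<And>N. \<bar>M2 N\<bar> powr p \<le> C2 * L N \<omega> powr p"
      using elim(2) by (auto simp: M2_def)
    define c where "c = max 0 C2 powr (1 / p)"
    have M2_le: "M2 N \<le> c * L N \<omega>" for N
    proof -
      have "\<bar>M2 N\<bar> powr p \<le> (c * L N \<omega>) powr p"
        using C2[of N] p L_ge[of N \<omega>]
        by (intro order_trans[OF C2]) (auto simp: c_def powr_mult powr_powr intro!: mult_right_mono)
      then have "\<bar>M2 N\<bar> \<le> c * L N \<omega>"
        using p L_ge[of N \<omega>] powr_mono2[of "1 / p" "\<bar>M2 N\<bar> powr p" "(c * L N \<omega>) powr p"]
        by (simp add: powr_powr c_def)
      then show ?thesis
        by simp
    qed
    \<comment> \<open>Compare \<open>C1\<close> with the square root \<open>q\<close> of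
      \<open>H\<close>: if \<open>C1 <= q\<close>, the square of \<open>M1\<close> is at most the
      square of \<open>H\<close>, otherwise at most \<open>C1 ^ 4\<close>.\<close>
    have M1_le: "M1 N \<le> H N \<omega> + C1\<^sup>2" for N
    proof -
      define q where "q = sqrt (H N \<omega>)"
      have q: "q \<ge> 1" "H N \<omega> = q\<^sup>2" "H N \<omega> powr (3/2) = q ^ 3"
        using H_ge[of N \<omega>] powr_powr[of "H N \<omega>" "1/2" 3] by (auto simp: q_def powr_half_sqrt powr_numeral)
      have sq: "(M1 N)\<^sup>2 \<le> C1 * q ^ 3"
        using M1_sq[of N] unfolding q(3) .
      then have "C1 \<ge> 0"
        using q(1) by (smt (verit) zero_le_power2 mult_neg_pos zero_less_power)
      show ?thesis
      proof (cases "C1 \<le> q")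
        case True
        then have "(M1 N)\<^sup>2 \<le> q * q ^ 3"
          using sq q by (intro order_trans[OF sq] mult_right_mono) auto
        also have "\<dots> = (q\<^sup>2)\<^sup>2"
          by (simp add: power2_eq_square power3_eq_cube)
        finally have "M1 N \<le> q\<^sup>2"
          by (rule power2_le_imp_le) simp
        then show ?thesis
          by (simp add: q add_increasing2)
      next
        case False
        then have "(M1 N)\<^sup>2 \<le> C1 * C1 ^ 3"
          using q \<open>C1 \<ge> 0\<close> by (intro order_trans[OF sq] mult_left_mono power_mono) auto
        also have "\<dots> = (C1\<^sup>2)\<^sup>2"
          by (simp add: power2_eq_square power3_eq_cube)
        finally have "M1 N \<le> C1\<^sup>2"
          by (rule power2_le_imp_le) simp
        then show ?thesis
          using H_ge[of N \<omega>] by simp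
      qed
    qed
    have compensator: "(\<Sum>n<N. a n \<omega> * s n \<omega>) \<le> (K + 1) * L N \<omega>" for N
    proof -
      have "(\<Sum>n<N. a n \<omega> * s n \<omega>) \<le> (\<Sum>n<N. (K + 1) * (L (Suc n) \<omega> - L n \<omega>))"
      proof (rule sum_mono)
        fix n
        have "a n \<omega> * s n \<omega> \<le> a n \<omega> * (K + 1)"
          using elim(3) a01 by (intro mult_left_mono) auto
        also have "\<dots> \<le> (L (Suc n) \<omega> - L n \<omega>) * (K + 1)"
          using a_le K by (intro mult_right_mono) auto
        finally show "a n \<omega> * s n \<omega> \<le> (K + 1) * (L (Suc n) \<omega> - L n \<omega>)"
          by (simp add: mult.commute)
      qed
      also have "\<dots> = (K + 1) * (L N \<omega> - L 0 \<omega>)"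
        by (simp add: sum_lessThan_telescope[of "\<lambda>n. L n \<omega>"] flip: sum_distrib_left)
      also have "\<dots> \<le> (K + 1) * L N \<omega>"
        using K L_ge[of 0 \<omega>] by (intro mult_left_mono) auto
      finally show ?thesis .
    qed
    \<comment> \<open>The 1 on the right is the initial value of \<open>H\<close>. With
      \<open>H\<close> on the left, it cancels the \<open>H\<close> in the bound on
      \<open>M1\<close>.\<close>
    have decomp: "self_normalized (X \<omega>) (V \<omega>) N + H N \<omega> = 1 + M1 N + M2 N + (\<Sum>n<N. a n \<omega> * s n \<omega>)" for N
    proof (induction N)
      case 0
      then show ?case
        by (simp add: self_normalized_def score_def H_def M1_def M2_def)
    next
      case (Suc N)
      have "self_normalized (X \<omega>) (V \<omega>) (Suc N) = self_normalized (X \<omega>) (V \<omega>) N - h N \<omega>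
          + 2 * g N \<omega> / (1 + b N \<omega>) * v N \<omega> + a N \<omega> * (v N \<omega>)\<^sup>2"
        by (simp add: self_normalized_Suc h_def g_def b_def a_def V_def)
      moreover have "a N \<omega> * (v N \<omega>)\<^sup>2 = a N \<omega> * z N \<omega> + a N \<omega> * s N \<omega>"
        by (simp add: z_def algebra_simps)
      moreover have "H (Suc N) \<omega> = H N \<omega> + h N \<omega>"
        by (simp add: H_def)
      ultimately show ?case
        using Suc by (simp add: M1_def M2_def)
    qed
    have "self_normalized (X \<omega>) (V \<omega>) N \<le> (1 + C1\<^sup>2 + c + (K + 1)) * L N \<omega>" for N
    proof -
      have "self_normalized (X \<omega>) (V \<omega>) N \<le> 1 + C1\<^sup>2 + c * L N \<omega> + (K + 1) * L N \<omega>"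
        using decomp[of N] M1_le[of N] M2_le[of N] compensator[of N] by linarith
      also have "1 + C1\<^sup>2 \<le> (1 + C1\<^sup>2) * L N \<omega>"
        using L_ge[of N \<omega>] mult_left_mono[of 1 "L N \<omega>" "1 + C1\<^sup>2"] by simp
      finally show ?thesis
        by (simp add: algebra_simps)
    qed
    then show ?case
      by (auto simp: X_def V_def L_def)
  qed
qed

text \<open>Localization: the noise is switched off as soon as a conditional moment exceeds \<open>K\<close>, and
  almost every path is left unchanged for some \<open>K\<close>.\<close>

lemma AE_self_normalized_bound_conditional_moments:
  fixes x :: "nat \<Rightarrow> 'a \<Rightarrow> 'b::euclidean_space" and v :: "nat \<Rightarrow> 'a \<Rightarrow> real" and \<gamma> :: real
  assumes \<gamma>: "2 < \<gamma>"
    and x: "\<And>n. x n \<in> borel_measurable (F n)"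
    and v: "\<And>n. v n \<in> borel_measurable (F (Suc n))"
    and v_int: "\<And>n. integrable M (v n)"
    and v_centered: "\<And>n. AE \<omega> in M. real_cond_exp M (F n) (v n) \<omega> = 0"
    and moment: "AE \<omega> in M. (SUP n. nn_cond_exp M (F n) (\<lambda>\<omega>. ennreal (\<bar>v n \<omega>\<bar> powr \<gamma>)) \<omega>) < \<infinity>"
  shows "AE \<omega> in M. \<exists>C. \<forall>N. self_normalized (\<lambda>k. x k \<omega>) (\<lambda>k. v k \<omega>) N
    \<le> C * (1 + log_volume (\<lambda>k. x k \<omega>) N)"
proof -
  interpret Fn: sigma_finite_subalgebra M "F n" for n
    by (rule sigma_finite_F)
  have [measurable]: "v n \<in> borel_measurable M" for n
    using measurable_F_M[OF v] .
  define \<mu> where "\<mu> = (\<lambda>n. nn_cond_exp M (F n) (\<lambda>\<omega>. ennreal (\<bar>v n \<omega>\<bar> powr \<gamma>)))"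
  \<comment> \<open>Moments of order \<open>2 * p\<close> are used, so \<open>p\<close> is half of
    \<open>\<gamma>\<close>, capped at 2 for the expansion inequality.\<close>
  define p where "p = min (\<gamma> / 2) 2"
  have p: "1 < p" "p \<le> 2" "2 * p \<le> \<gamma>"
    using \<gamma> by (auto simp: p_def)
  have bound: "AE \<omega> in M. \<exists>C. \<forall>N. self_normalized (\<lambda>k. x k \<omega>) (\<lambda>k. indicator {\<omega>\<in>space M. \<forall>i\<in>{..k}. \<mu> i \<omega> \<le> of_nat K} \<omega> * v k \<omega>) N
    \<le> C * (1 + log_volume (\<lambda>k. x k \<omega>) N)" for K
  proof -
    \<comment> \<open>Only conditional moments given the past up to \<open>n\<close> enter, so
      \<open>E n\<close> lies in \<open>F n\<close> and multiplying \<open>v n\<close> by its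
      indicator preserves centring.\<close>
    define E where "E = (\<lambda>n. {\<omega>\<in>space M. \<forall>i\<in>{..n}. \<mu> i \<omega> \<le> of_nat K})"
    define V where "V = (\<lambda>n \<omega>. indicator (E n) \<omega> * v n \<omega>)"
    have \<mu>_meas: "\<mu> i \<in> borel_measurable (F n)" if "i \<le> n" for i n
      unfolding \<mu>_def by (rule measurable_F_mono[OF _ that]) measurable
    have E_F: "E n \<in> sets (F n)" for n
    proof -
      have "{\<omega>\<in>space (F n). \<mu> i \<omega> \<le> of_nat K} \<in> sets (F n)" if "i \<in> {..n}" for i
        using borel_measurable_le[OF \<mu>_meas[of i n] borel_measurable_const] that by simp
      then have "{\<omega>\<in>space (F n). \<forall>i\<in>{..n}. \<mu> i \<omega> \<le> of_nat K} \<in> sets (F n)"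
        by (intro sets.sets_Collect_finite_All) auto
      then show ?thesis
        by (simp add: E_def space_F)
    qed
    have [measurable]: "E n \<in> sets M" for n
      by (rule sets_F_M[OF E_F])
    have V_powr: "ennreal (\<bar>V n \<omega>\<bar> powr \<gamma>) = indicator (E n) \<omega> * ennreal (\<bar>v n \<omega>\<bar> powr \<gamma>)" for n \<omega>
      by (simp add: V_def indicator_def)
    have E_le: "indicator (E n) \<omega> * \<mu> n \<omega> \<le> of_nat K" for n \<omega>
      by (simp add: E_def indicator_def)
    \<comment> \<open>An unconditional moment of \<open>v n\<close> of order \<open>\<gamma>\<close>
      may be infinite. The conditional moment in \<open>ennreal\<close> exists all the same, and its
      integral over \<open>E n\<close> is at most \<open>K\<close>.\<close>
    have "(\<integral>\<^sup>+\<omega>. ennreal (\<bar>V n \<omega>\<bar> powr \<gamma>) \<partial>M) < \<infinity>" for n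
    proof -
      have "(\<integral>\<^sup>+\<omega>. ennreal (\<bar>V n \<omega>\<bar> powr \<gamma>) \<partial>M) = (\<integral>\<^sup>+\<omega>. indicator (E n) \<omega> * \<mu> n \<omega> \<partial>M)"
        unfolding V_powr \<mu>_def
        by (rule Fn.nn_cond_exp_intg[OF borel_measurable_indicator[OF E_F], symmetric]) measurable
      also have "\<dots> \<le> (\<integral>\<^sup>+\<omega>. of_nat K \<partial>M)"
        by (intro nn_integral_mono E_le)
      also have "\<dots> < \<infinity>"
        by (simp add: emeasure_space_1 of_nat_less_top)
      finally show ?thesis .
    qed
    then have V_powr_int: "integrable M (\<lambda>\<omega>. \<bar>V n \<omega>\<bar> powr \<gamma>)" for n
      by (intro integrableI_nonneg) (auto simp: V_def)
    have V_powr_rce: "AE \<omega> in M. real_cond_exp M (F n) (\<lambda>\<omega>. \<bar>V n \<omega>\<bar> powr \<gamma>) \<omega> \<le> real K" for n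
    proof -
      have "AE \<omega> in M. indicator (E n) \<omega> * \<mu> n \<omega> = nn_cond_exp M (F n) (\<lambda>\<omega>. ennreal (\<bar>V n \<omega>\<bar> powr \<gamma>)) \<omega>"
        unfolding V_powr \<mu>_def
        by (rule Fn.nn_cond_exp_prod[OF borel_measurable_indicator[OF E_F]]) measurable
      then show ?thesis
      proof eventually_elim
        case (elim \<omega>)
        have "enn2real (nn_cond_exp M (F n) (\<lambda>\<omega>. ennreal (\<bar>V n \<omega>\<bar> powr \<gamma>)) \<omega>) \<le> real K"
          using E_le[of n \<omega>] unfolding elim by (intro enn2real_leI) (simp_all add: ennreal_of_nat_eq_real_of_nat)
        moreover have "0 \<le> enn2real (nn_cond_exp M (F n) (\<lambda>\<omega>. ennreal (- (\<bar>V n \<omega>\<bar> powr \<gamma>))) \<omega>)"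
          by simp
        ultimately show ?case
          unfolding real_cond_exp_def by linarith
      qed
    qed
    have powr_le: "t powr (2 * p) \<le> 1 * t powr \<gamma> + 1" if "t \<ge> 0" for t :: real
    proof (cases "t \<le> 1")
      case True
      then have "t powr (2 * p) \<le> 1"
        using p that by (intro powr_le1) auto
      then show ?thesis
        by (simp add: add_increasing)
    next
      case False
      then have "t powr (2 * p) \<le> t powr \<gamma>"
        using p by (intro powr_mono) auto
      then show ?thesis
        by simp
    qed
    have V_int: "integrable M (V n)" for n
      using integrable_mult_indicator[OF \<open>E n \<in> sets M\<close> v_int] by (simp add: V_def)
    have V_moment_int: "integrable M (\<lambda>\<omega>. \<bar>V n \<omega>\<bar> powr (2 * p))" for n
    proof (rule Bochner_Integration.integrable_bound)
      show "integrable M (\<lambda>\<omega>. 1 * \<bar>V n \<omega>\<bar> powr \<gamma> + 1)"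
        by (intro Bochner_Integration.integrable_add integrable_mult_right V_powr_int) simp
      show "AE \<omega> in M. norm (\<bar>V n \<omega>\<bar> powr (2 * p)) \<le> norm (1 * \<bar>V n \<omega>\<bar> powr \<gamma> + 1)"
        using powr_le by (intro AE_I2) (simp add: add_nonneg_nonneg)
      show "(\<lambda>\<omega>. \<bar>V n \<omega>\<bar> powr (2 * p)) \<in> borel_measurable M"
        unfolding V_def by measurable
    qed
    have "AE \<omega> in M. \<exists>C. \<forall>N. self_normalized (\<lambda>k. x k \<omega>) (\<lambda>k. V k \<omega>) N
      \<le> C * (1 + log_volume (\<lambda>k. x k \<omega>) N)"
    proof (rule AE_self_normalized_bound[OF p(1,2) x _ V_int _ V_moment_int])
      show "V n \<in> borel_measurable (F (Suc n))" for n
        unfolding V_def using v[of n] sets_F_mono[of n] E_F[of n]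
        by (intro borel_measurable_times borel_measurable_indicator) auto
      show "AE \<omega> in M. real_cond_exp M (F n) (V n) \<omega> = 0" for n
      proof -
        have "AE \<omega> in M. real_cond_exp M (F n) (V n) \<omega> = indicator (E n) \<omega> * real_cond_exp M (F n) (v n) \<omega>"
          unfolding V_def using E_F[of n] V_int[of n] by (intro Fn.real_cond_exp_mult) (auto simp: V_def)
        then show ?thesis
          using v_centered[of n] by eventually_elim simp
      qed
      show "AE \<omega> in M. real_cond_exp M (F n) (\<lambda>\<omega>. \<bar>V n \<omega>\<bar> powr (2 * p)) \<omega> \<le> 1 * real K + 1" for n
        using powr_le by (intro real_cond_exp_affine_bound[OF V_powr_int V_moment_int _ _ V_powr_rce] AE_I2) auto
    qed simp
    then show ?thesis
      by (simp only: V_def E_def)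
  qed
  then have "AE \<omega> in M. \<forall>K. \<exists>C. \<forall>N. self_normalized (\<lambda>k. x k \<omega>) (\<lambda>k. indicator {\<omega>\<in>space M. \<forall>i\<in>{..k}. \<mu> i \<omega> \<le> of_nat K} \<omega> * v k \<omega>) N
    \<le> C * (1 + log_volume (\<lambda>k. x k \<omega>) N)"
    by (subst AE_all_countable) blast
  with moment AE_space show ?thesis
  proof eventually_elim
    case (elim \<omega>)
    obtain K where "(SUP n. \<mu> n \<omega>) < of_nat K"
      using elim(1) ennreal_Ex_less_of_nat[of "SUP n. \<mu> n \<omega>"] by (auto simp: \<mu>_def)
    then have "\<mu> n \<omega> \<le> of_nat K" for n
      by (meson SUP_upper UNIV_I less_imp_le order_trans)
    then have "indicator {\<omega>\<in>space M. \<forall>i\<in>{..k}. \<mu> i \<omega> \<le> of_nat K} \<omega> * v k \<omega> = v k \<omega>" for k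
      using elim(2) by simp
    then show ?case
      using elim(3)[rule_format, of K] by presburger
  qed
qed

end

subsection \<open>Symmetric operators and their extreme eigenvalues\<close>

lemma inner_self_le_0_iff: "v \<bullet> v \<le> 0 \<longleftrightarrow> v = 0"
  by (metis inner_eq_zero_iff inner_ge_zero order_antisym order_refl)

text \<open>At \<open>v\<close> the nonnegative form attains its minimum 0, so its gradient
  \<open>2 * f v\<close> vanishes. The test step along \<open>- f v\<close> has a length
  \<open>t\<close> for which the quadratic term is at most half the linear one.\<close>

lemma psd_null_vector:
  fixes f :: "'b::euclidean_space \<Rightarrow> 'b"
  assumes f: "linear f" and sym: "\<And>u v. u \<bullet> f v = f u \<bullet> v"
    and psd: "\<And>u. 0 \<le> u \<bullet> f u" and null: "v \<bullet> f v = 0"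
  shows "f v = 0"
proof (rule ccontr)
  assume "f v \<noteq> 0"
  define a where "a = f v"
  define t where "t = (a \<bullet> a) / (1 + a \<bullet> f a)"
  have pos: "0 < a \<bullet> a" "0 < 1 + a \<bullet> f a"
    using \<open>f v \<noteq> 0\<close> psd[of a] by (auto simp: a_def add_pos_nonneg)
  then have "t > 0"
    by (simp add: t_def)
  have "0 \<le> (v - t *\<^sub>R a) \<bullet> f (v - t *\<^sub>R a)"
    by (rule psd)
  also have "\<dots> = t * (t * (a \<bullet> f a) - 2 * (a \<bullet> a))"
    using null sym[of v a] by (simp add: linear_diff[OF f] linear_scale[OF f] inner_diff a_def inner_commute algebra_simps)
  finally have "2 * (a \<bullet> a) \<le> t * (a \<bullet> f a)"
    using \<open>t > 0\<close> by (simp add: zero_le_mult_iff)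
  also have "\<dots> \<le> t * (1 + a \<bullet> f a)"
    using \<open>t > 0\<close> by simp
  also have "\<dots> = a \<bullet> a"
    using pos by (simp add: t_def)
  finally show False
    using pos by simp
qed

text \<open>The Rayleigh quotient attains a maximum \<open>l\<close> on the unit sphere; the form of
  \<open>l\<close> times the identity minus \<open>f\<close> is then nonnegative and vanishes at the
  maximiser, so \<open>psd_null_vector\<close> applies.\<close>

lemma symmetric_operator_max_eigenvalue:
  fixes f :: "'b::euclidean_space \<Rightarrow> 'b"
  assumes f: "linear f" and sym: "\<And>u v. u \<bullet> f v = f u \<bullet> v"
  obtains l v where "v \<noteq> 0" "f v = l *\<^sub>R v" "\<And>u. u \<bullet> f u \<le> l * (u \<bullet> u)"
proof -
  have "continuous_on (sphere 0 1) (\<lambda>u. u \<bullet> f u)"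
    by (intro continuous_intros linear_continuous_on linear_conv_bounded_linear[THEN iffD1] f)
  moreover have "sphere (0::'b) 1 \<noteq> {}"
    by simp
  ultimately obtain v where v: "v \<in> sphere 0 1" "\<And>u. u \<in> sphere 0 1 \<Longrightarrow> u \<bullet> f u \<le> v \<bullet> f v"
    using continuous_attains_sup[OF compact_sphere] by blast
  define l where "l = v \<bullet> f v"
  have bound: "u \<bullet> f u \<le> l * (u \<bullet> u)" for u
  proof (cases "u = 0")
    case False
    have "(u /\<^sub>R norm u) \<bullet> f (u /\<^sub>R norm u) \<le> l"
      using False unfolding l_def by (intro v) simp
    then have "u \<bullet> f u \<le> l * (norm u * norm u)"
      using False by (simp add: linear_scale[OF f] field_simps)
    then show ?thesis
      by (simp add: dot_square_norm power2_eq_square)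
  qed simp
  define g where "g = (\<lambda>u. l *\<^sub>R u - f u)"
  have "linear g"
    unfolding g_def by (intro linear_compose_sub f linear_scaleR)
  moreover have "v \<bullet> v = 1"
    using v(1) by (simp add: dot_square_norm)
  then have "v \<bullet> g v = 0"
    by (simp add: g_def inner_diff_right l_def)
  moreover have "u \<bullet> g z = g u \<bullet> z" for u z
    using sym[of u z] by (simp add: g_def inner_diff)
  moreover have "0 \<le> u \<bullet> g u" for u
    using bound[of u] by (simp add: g_def inner_diff_right)
  ultimately have "g v = 0"
    using psd_null_vector[OF \<open>linear g\<close>] by blast
  then show ?thesis
    using bound v(1) by (intro that[of v l]) (auto simp: g_def)
qed

text \<open>Eigenvectors of distinct eigenvalues are orthogonal, hence independent. Finiteness gives
  \<open>Max\<close> and \<open>Min\<close> in \<open>lambda_max\<close> and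
  \<open>lambda_min\<close> their meaning.\<close>

lemma finite_eigenvalues:
  fixes A :: "real ^ 'r ^ 'r"
  assumes sym: "\<And>u v. u \<bullet> (A *v v) = (A *v u) \<bullet> v"
  shows "finite (eigenvalues A)"
proof -
  have "\<forall>l\<in>eigenvalues A. \<exists>v. v \<noteq> 0 \<and> A *v v = l *\<^sub>R v"
    by (auto simp: eigenvalues_def)
  then obtain e where e: "\<And>l. l \<in> eigenvalues A \<Longrightarrow> e l \<noteq> 0 \<and> A *v e l = l *\<^sub>R e l"
    by metis
  have orth: "e l \<bullet> e m = 0" if "l \<in> eigenvalues A" "m \<in> eigenvalues A" "l \<noteq> m" for l m
    using e[OF that(1)] e[OF that(2)] sym[of "e l" "e m"] that(3) by simp
  have "inj_on e (eigenvalues A)"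
    by (rule inj_onI) (metis orth e inner_eq_zero_iff)
  moreover have "independent (e ` eigenvalues A)"
    using e orth by (intro pairwise_orthogonal_independent) (auto simp: pairwise_def orthogonal_def)
  ultimately show ?thesis
    by (metis independent_imp_finite finite_image_iff)
qed

lemma gram_mult_vec: "gram x N *v v = (\<Sum>k=1..N. (x k \<bullet> v) *\<^sub>R x k)"
proof -
  have "outer z z *v v = (z \<bullet> v) *\<^sub>R z" for z :: "real ^ 'a"
    by (simp add: vec_eq_iff outer_def matrix_vector_mult_def inner_vec_def sum_distrib_left mult_ac)
  moreover have "sum g S *v v = (\<Sum>k\<in>S. g k *v v)" for g :: "nat \<Rightarrow> real^'a^'a" and S
    by (induction S rule: infinite_finite_induct) (auto simp: matrix_vector_mult_add_rdistrib)
  ultimately show ?thesis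
    by (simp add: gram_def)
qed

lemma inner_gram: "u \<bullet> (gram x N *v v) = (\<Sum>k=1..N. (x k \<bullet> u) * (x k \<bullet> v))"
  by (simp add: gram_mult_vec inner_sum_right inner_commute mult.commute)

lemma gram_symmetric: "u \<bullet> (gram x N *v v) = (gram x N *v u) \<bullet> v"
  unfolding inner_commute[of "gram x N *v u" v] inner_gram by (simp add: mult.commute)

lemma gram_psd: "0 \<le> u \<bullet> (gram x N *v u)"
  by (auto simp: inner_gram intro!: sum_nonneg)

text \<open>The Gram matrix and its negative yield eigenvalues \<open>l\<close> and
  \<open>- m\<close> that bound the form; passing to \<open>Max\<close> and \<open>Min\<close> of
  the spectrum can only weaken these bounds.\<close>

lemma
  shows lambda_max_bound: "u \<bullet> (gram x N *v u) \<le> lambda_max x N * (u \<bullet> u)"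
    and lambda_min_bound: "lambda_min x N * (u \<bullet> u) \<le> u \<bullet> (gram x N *v u)"
    and lambda_min_nonneg: "0 \<le> lambda_min x N"
    and lambda_min_le_max: "lambda_min x N \<le> lambda_max x N"
proof -
  define E where "E = eigenvalues (gram x N)"
  have fin: "finite E"
    unfolding E_def using gram_symmetric by (rule finite_eigenvalues)
  obtain l v where l: "v \<noteq> 0" "gram x N *v v = l *\<^sub>R v" "\<And>u. u \<bullet> (gram x N *v u) \<le> l * (u \<bullet> u)"
    using symmetric_operator_max_eigenvalue[OF matrix_vector_mul_linear gram_symmetric] by blast
  have lin: "linear (\<lambda>v. - (gram x N *v v))"
    by (intro linear_compose_neg matrix_vector_mul_linear)
  have "u \<bullet> - (gram x N *v v) = - (gram x N *v u) \<bullet> v" for u v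
    using gram_symmetric[of u x N v] by simp
  then obtain m z where "z \<noteq> 0" "- (gram x N *v z) = m *\<^sub>R z" "\<And>u. u \<bullet> - (gram x N *v u) \<le> m * (u \<bullet> u)"
    using symmetric_operator_max_eigenvalue[OF lin] by blast
  then have m: "z \<noteq> 0" "gram x N *v z = (- m) *\<^sub>R z" "\<And>u. (- m) * (u \<bullet> u) \<le> u \<bullet> (gram x N *v u)"
    by (auto simp: minus_equation_iff minus_le_iff)
  have E: "l \<in> E" "- m \<in> E"
    using l m by (auto simp: E_def eigenvalues_def)
  have "l \<le> lambda_max x N"
    unfolding lambda_max_def E_def[symmetric] by (intro Max_ge fin E)
  then show "u \<bullet> (gram x N *v u) \<le> lambda_max x N * (u \<bullet> u)"
    by (meson l(3) inner_ge_zero mult_right_mono order_trans)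
  have "lambda_min x N \<le> - m"
    unfolding lambda_min_def E_def[symmetric] by (intro Min_le fin E)
  then show "lambda_min x N * (u \<bullet> u) \<le> u \<bullet> (gram x N *v u)"
    by (meson m(3) inner_ge_zero mult_right_mono order_trans)
  have "lambda_min x N \<in> E"
    unfolding lambda_min_def E_def[symmetric] using E fin by (intro Min_in) auto
  then obtain v' where "v' \<noteq> 0" "gram x N *v v' = lambda_min x N *\<^sub>R v'"
    by (auto simp: E_def eigenvalues_def)
  then show "0 \<le> lambda_min x N"
    using gram_psd[of v' x N] by (auto simp: zero_le_mult_iff inner_self_le_0_iff)
  show "lambda_min x N \<le> lambda_max x N"
    using \<open>lambda_min x N \<in> E\<close> unfolding lambda_max_def E_def[symmetric] by (intro Max_ge fin)
qed

lemma gram_inner_bound: "\<bar>u \<bullet> (gram x N *v v)\<bar> \<le> lambda_max x N * norm u * norm v"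
proof -
  have pos: "0 \<le> lambda_max x N"
    using lambda_min_nonneg lambda_min_le_max order_trans by blast
  have "(u \<bullet> (gram x N *v v))\<^sup>2 \<le> (u \<bullet> (gram x N *v u)) * (v \<bullet> (gram x N *v v))"
    unfolding inner_gram using Cauchy_Schwarz_ineq_sum[of "\<lambda>k. x k \<bullet> u" "\<lambda>k. x k \<bullet> v" "{1..N}"]
    by (simp add: power2_eq_square)
  also have "\<dots> \<le> (lambda_max x N * (u \<bullet> u)) * (lambda_max x N * (v \<bullet> v))"
    using pos by (intro mult_mono lambda_max_bound gram_psd) auto
  also have "\<dots> = (lambda_max x N * norm u * norm v)\<^sup>2"
    by (simp add: dot_square_norm power_mult_distrib) (simp add: power2_eq_square)
  finally show ?thesis
    using pos by (simp add: abs_le_square_iff[symmetric] abs_mult)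
qed

text \<open>These are the normal equations. \<open>matrix_inv\<close> is a choice, so invertibility
  comes first: a positive \<open>lambda_min\<close> makes the kernel trivial.\<close>

lemma gram_ls_estimate:
  assumes "lambda_min x N > 0"
  shows "gram x N *v ls_estimate x y N = (\<Sum>k=1..N. y (k + 1) *\<^sub>R x k)"
proof -
  have "v = 0" if "gram x N *v v = 0" for v
    using lambda_min_bound[of x N v] that assms by (auto simp: mult_le_0_iff inner_self_le_0_iff)
  then have "invertible (gram x N)"
    by (simp add: invertible_left_inverse matrix_left_invertible_ker)
  then have "gram x N ** matrix_inv (gram x N) = mat 1"
    unfolding invertible_def matrix_inv_def by (metis (mono_tags, lifting) someI_ex)
  then show ?thesis
    by (simp add: ls_estimate_def matrix_vector_mul_assoc)
qed

subsection \<open>Determinants of rank-one updates\<close>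

text \<open>The rows of I are replaced by those of I + u v^T one at a time, \<open>c S\<close> being
  the stage with the rows in \<open>S\<close> replaced. Linearity in row \<open>k\<close> leaves a
  determinant with row \<open>v\<close> at \<open>k\<close>; there row operations remove
  \<open>v\<close> from the other rows, and Cramer's rule gives \<open>v $ k\<close>.\<close>

lemma det_identity_plus_outer:
  fixes u v :: "real ^ 'r"
  shows "det (mat 1 + outer u v) = 1 + u \<bullet> v"
proof -
  define c where "c = (\<lambda>S i. if i \<in> S then axis i 1 + u $ i *s v else axis i (1 :: real))"
  have replaced: "det (\<chi> i. if i = k then v else c S i) = v $ k" if "finite S" "k \<notin> S" for S k
    using that
  proof (induction S)
    case empty
    have "row i (mat 1) = (axis i 1 :: real ^ 'r)" for i
      by (simp add: row_def mat_def axis_def vec_eq_iff)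
    then have "(\<chi> i. if i = k then v else c {} i) =
        (\<chi> i. if i = k then \<Sum>i\<in>UNIV. v $ i *s row i (mat 1) else row i (mat 1))"
      by (simp add: c_def basis_expansion cong: if_cong)
    then show ?case
      by (simp only: cramer_lemma_transpose det_I mult_1_right)
  next
    case (insert j S)
    define B where "B = (\<chi> i. if i = k then v else c S i)"
    have "j \<noteq> k"
      using insert by auto
    have "row i B = (if i = k then v else c S i)" for i
      by (simp add: B_def row_def vec_eq_iff)
    then have "(\<chi> i. if i = j then row j B + u $ j *s row k B else row i B) = (\<chi> i. if i = k then v else c (insert j S) i)"
      using insert \<open>j \<noteq> k\<close> by (auto simp: vec_eq_iff c_def)
    then have "det (\<chi> i. if i = k then v else c (insert j S) i) = det B"
      using det_row_operation[OF \<open>j \<noteq> k\<close>, of B "u $ j"] by simp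
    then show ?case
      using insert by (simp add: B_def)
  qed
  have "det (\<chi> i. c S i) = 1 + (\<Sum>i\<in>S. u $ i * v $ i)" if "finite S" for S
    using that
  proof (induction S)
    case empty
    have "(\<chi> i. c {} i) = mat 1"
      by (simp add: c_def mat_def axis_def vec_eq_iff)
    then show ?case
      by simp
  next
    case (insert k S)
    have "(\<chi> i. c (insert k S) i) = (\<chi> i. if i = k then axis i 1 + u $ k *s v else c S i)"
      by (auto simp: c_def vec_eq_iff)
    then have "det (\<chi> i. c (insert k S) i) = det (\<chi> i. if i = k then axis i 1 else c S i)
        + u $ k * det (\<chi> i. if i = k then v else c S i)"
      by (simp add: det_row_add det_row_mul)
    also have "(\<chi> i. if i = k then axis i 1 else c S i) = (\<chi> i. c S i)"
      using insert by (auto simp: c_def vec_eq_iff)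
    finally show ?case
      using insert by (simp add: replaced)
  qed
  from this[of UNIV] have "det (\<chi> i. c UNIV i) = 1 + u \<bullet> v"
    by (simp add: inner_vec_def)
  moreover have "(\<chi> i. c UNIV i) = mat 1 + outer u v"
    by (simp add: c_def mat_def axis_def outer_def vec_eq_iff)
  ultimately show ?thesis
    by simp
qed

lemma outer_mult_vec: "outer u v *v z = (v \<bullet> z) *\<^sub>R u"
  by (simp add: vec_eq_iff outer_def matrix_vector_mult_def inner_vec_def sum_distrib_left mult_ac)

text \<open>A solution \<open>z\<close> factors the update as
  \<open>A ** (mat 1 + outer z v)\<close>.\<close>

lemma det_rank_one_update:
  fixes A :: "real ^ 'r ^ 'r"
  assumes "A *v z = u"
  shows "det (A + outer u v) = det A * (1 + z \<bullet> v)"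
proof -
  have "A + outer u v = A ** (mat 1 + outer z v)"
    by (rule matrix_eq[THEN iffD2])
      (simp add: matrix_vector_mult_add_rdistrib outer_mult_vec matrix_vector_mul_assoc[symmetric]
        matrix_vector_right_distrib matrix_vector_mult_scaleR assms)
  then show ?thesis
    by (simp add: det_mul det_identity_plus_outer)
qed

text \<open>The crude Leibniz bound is adequate because only its logarithm enters, where the
  factorial becomes an additive constant.\<close>

lemma abs_det_le:
  fixes A :: "real ^ 'r ^ 'r"
  assumes "\<And>i j. \<bar>A $ i $ j\<bar> \<le> c"
  shows "\<bar>det A\<bar> \<le> fact CARD('r) * c ^ CARD('r)"
proof -
  have "\<bar>det A\<bar> \<le> (\<Sum>q | q permutes (UNIV :: 'r set). \<bar>of_int (Permutations.sign q) * (\<Prod>i\<in>UNIV. A $ i $ q i)\<bar>)"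
    unfolding det_def by (rule sum_abs)
  also have "\<dots> \<le> (\<Sum>q | q permutes (UNIV :: 'r set). c ^ CARD('r))"
  proof (rule sum_mono)
    fix q :: "'r \<Rightarrow> 'r"
    have "\<bar>of_int (Permutations.sign q) * (\<Prod>i\<in>UNIV. A $ i $ q i)\<bar> = (\<Prod>i\<in>UNIV. \<bar>A $ i $ q i\<bar>)"
      by (simp add: abs_mult Permutations.sign_def abs_prod)
    also have "\<dots> \<le> (\<Prod>i\<in>(UNIV :: 'r set). c)"
      by (intro prod_mono) (simp add: assms)
    finally show "\<bar>of_int (Permutations.sign q) * (\<Prod>i\<in>UNIV. A $ i $ q i)\<bar> \<le> c ^ CARD('r)"
      by simp
  qed
  also have "\<dots> = fact CARD('r) * c ^ CARD('r)"
    by (simp add: card_permutations[OF refl])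
  finally show ?thesis .
qed

lemma gram_Suc: "gram x (Suc N) = gram x N + outer (x (Suc N)) (x (Suc N))"
  by (simp add: gram_def)

text \<open>\<open>gram\<close> sums over times 1 to \<open>N\<close>, the ridge recursion over 0 to
  \<open>N - 1\<close>; hence the shifted regressor \<open>x (Suc k)\<close>, whose noise partner
  below is \<open>w (k + 2)\<close>.\<close>

lemma ridge_op_eq_gram: "ridge_op (\<lambda>k. x (Suc k)) N z = (mat 1 + gram x N) *v z"
  by (simp add: ridge_op_def gram_mult_vec matrix_vector_mult_add_rdistrib sum.atLeast1_atMost_eq)

text \<open>Each update multiplies the determinant by one plus the leverage, since
  \<open>ridge_inv\<close> solves the linear system in \<open>det_rank_one_update\<close>.\<close>

lemma det_ridge: "det (mat 1 + gram x N) = exp (log_volume (\<lambda>k. x (Suc k)) N)"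
proof (induction N)
  case 0
  then show ?case
    by (simp add: gram_def log_volume_def)
next
  case (Suc N)
  define z where "z = ridge_inv (\<lambda>k. x (Suc k)) N (x (Suc N))"
  have "(mat 1 + gram x N) *v z = x (Suc N)"
    by (simp add: z_def ridge_op_inv flip: ridge_op_eq_gram)
  then have "det (mat 1 + gram x N + outer (x (Suc N)) (x (Suc N))) = det (mat 1 + gram x N) * (1 + z \<bullet> x (Suc N))"
    by (rule det_rank_one_update)
  also have "z \<bullet> x (Suc N) = leverage (\<lambda>k. x (Suc k)) N"
    by (simp add: leverage_def z_def inner_commute)
  finally show ?case
    using leverage_nonneg[of "\<lambda>k. x (Suc k)" N]
    by (simp add: Suc log_volume_Suc exp_add gram_Suc add.assoc[symmetric])
qed

lemma log_volume_le:
  fixes x :: "nat \<Rightarrow> real ^ 'r"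
  shows "log_volume (\<lambda>k. x (Suc k)) N \<le> ln (fact CARD('r)) + CARD('r) * ln (1 + lambda_max x N)"
proof -
  have nonneg: "0 \<le> lambda_max x N"
    using lambda_min_nonneg lambda_min_le_max order_trans by blast
  have "\<bar>(mat 1 + gram x N) $ i $ j\<bar> \<le> 1 + lambda_max x N" for i j
  proof -
    have "gram x N $ i $ j = axis i 1 \<bullet> (gram x N *v axis j 1)"
      by (simp add: inner_axis' matrix_vector_mult_basis column_def)
    then have "\<bar>gram x N $ i $ j\<bar> \<le> lambda_max x N"
      using gram_inner_bound[of "axis i 1" x N "axis j 1"] by simp
    then show ?thesis
      by (auto simp: mat_def)
  qed
  then have "exp (log_volume (\<lambda>k. x (Suc k)) N) \<le> fact CARD('r) * (1 + lambda_max x N) ^ CARD('r)"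
    using abs_det_le[of "mat 1 + gram x N" "1 + lambda_max x N"] by (simp add: det_ridge)
  then have "log_volume (\<lambda>k. x (Suc k)) N \<le> ln (fact CARD('r) * (1 + lambda_max x N) ^ CARD('r))"
    using nonneg by (subst ln_ge_iff) auto
  then show ?thesis
    using nonneg by (simp add: ln_mult ln_realpow)
qed

text \<open>The error \<open>d\<close> solves \<open>gram x N *v d = S\<close> with \<open>S\<close>
  the score, so \<open>a * (d \<bullet> d) <= d \<bullet> S\<close>; it remains to bound
  \<open>d \<bullet> S\<close> by the self-normalized score.\<close>

lemma ls_estimate_error:
  fixes x :: "nat \<Rightarrow> real ^ 'r" and \<theta> :: "real ^ 'r" and y w :: "nat \<Rightarrow> real"
  assumes system: "\<And>k. k \<ge> 1 \<Longrightarrow> y (k + 1) = \<theta> \<bullet> x k + w (k + 1)"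
    and lmin: "filterlim (lambda_min x) at_top sequentially"
    and bound: "\<And>N. self_normalized (\<lambda>k. x (Suc k)) (\<lambda>k. w (k + 2)) N
      \<le> C * (1 + log_volume (\<lambda>k. x (Suc k)) N)"
  shows "\<exists>K. \<forall>\<^sub>F N in sequentially.
    norm (ls_estimate x y N - \<theta>) \<le> K * sqrt (ln (lambda_max x N) / lambda_min x N)"
proof -
  define c where "c = max 0 C"
  define K where "K = 2 * (c * (1 + ln (fact CARD('r)) + 2 * CARD('r)))"
  have K: "K \<ge> 0"
    by (simp add: K_def c_def)
  \<comment> \<open>The threshold 3 ensures \<open>1 <= ln b\<close> and
    \<open>1 + b <= b ^ 2\<close>, by which all additive constants are absorbed in
    \<open>ln b\<close>.\<close>
  have "\<forall>\<^sub>F N in sequentially. lambda_min x N > 3"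
    using lmin by (simp add: filterlim_at_top_dense)
  then have "\<forall>\<^sub>F N in sequentially.
    norm (ls_estimate x y N - \<theta>) \<le> sqrt K * sqrt (ln (lambda_max x N) / lambda_min x N)"
  proof eventually_elim
    case (elim N)
    define d where "d = ls_estimate x y N - \<theta>"
    define a where "a = lambda_min x N"
    define b where "b = lambda_max x N"
    define L where "L = log_volume (\<lambda>k. x (Suc k)) N"
    define S where "S = score (\<lambda>k. x (Suc k)) (\<lambda>k. w (k + 2)) N"
    have ab: "3 < a" "a \<le> b"
      using elim lambda_min_le_max by (auto simp: a_def b_def)
    have "(\<Sum>k=1..N. y (k + 1) *\<^sub>R x k) = gram x N *v \<theta> + (\<Sum>k=1..N. w (k + 1) *\<^sub>R x k)"
      unfolding gram_mult_vec sum.distrib[symmetric]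
    proof (intro sum.cong refl)
      fix k assume "k \<in> {1..N}"
      then show "y (k + 1) *\<^sub>R x k = (x k \<bullet> \<theta>) *\<^sub>R x k + w (k + 1) *\<^sub>R x k"
        by (subst system) (simp_all add: inner_commute scaleR_add_left)
    qed
    moreover have "(\<Sum>k=1..N. w (k + 1) *\<^sub>R x k) = S"
      by (simp add: S_def score_def sum.atLeast1_atMost_eq)
    ultimately have S: "gram x N *v d = S"
      using gram_ls_estimate[of x N y] elim by (simp add: d_def matrix_vector_mult_diff_distrib)
    have dd: "a * (d \<bullet> d) \<le> d \<bullet> S"
      unfolding a_def S[symmetric] by (rule lambda_min_bound)
    have "1 * (d \<bullet> d) \<le> a * (d \<bullet> d)"
      using ab by (intro mult_right_mono) auto
    with dd have dS: "d \<bullet> d \<le> d \<bullet> S"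
      by linarith
    have "ridge_op (\<lambda>k. x (Suc k)) N d = d + S"
      by (simp add: ridge_op_eq_gram matrix_vector_mult_add_rdistrib S)
    \<comment> \<open>Taking half of \<open>d\<close> in the variational bound makes the quadratic
      term \<open>(d \<bullet> d + d \<bullet> S) / 4\<close>, at most half of
      \<open>d \<bullet> S\<close> by \<open>dS\<close>.\<close>
    then have "d \<bullet> S - (d \<bullet> d + d \<bullet> S) / 4 \<le> self_normalized (\<lambda>k. x (Suc k)) (\<lambda>k. w (k + 2)) N"
      using self_normalized_lower_bound[of "(1/2) *\<^sub>R d" "\<lambda>k. x (Suc k)" "\<lambda>k. w (k + 2)" N]
      by (simp add: linear_scale[OF linear_ridge_op] inner_add_right S_def add_divide_distrib)
    also have "\<dots> \<le> C * (1 + L)"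
      unfolding L_def by (rule bound)
    also have "\<dots> \<le> c * (1 + L)"
      by (intro mult_right_mono) (auto simp: c_def L_def log_volume_nonneg add_nonneg_nonneg)
    finally have "d \<bullet> S - (d \<bullet> d + d \<bullet> S) / 4 \<le> c * (1 + L)" .
    then have "d \<bullet> S \<le> 2 * (c * (1 + L))"
      using dS by (simp add: field_simps)
    with dd have 1: "a * (d \<bullet> d) \<le> 2 * (c * (1 + L))"
      by (rule order_trans)
    have "exp 1 \<le> b"
      using ab exp_le by linarith
    then have ln1: "1 \<le> ln b"
      using ab by (simp add: ln_ge_iff)
    have "1 + b \<le> b ^ 2"
    proof -
      have "3 * b \<le> b * b"
        using ab by (intro mult_right_mono) auto
      then show ?thesis
        unfolding power2_eq_square using ab by linarith
    qed
    then have "ln (1 + b) \<le> ln (b ^ 2)"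
      using ab by (subst ln_le_cancel_iff) auto
    then have ln2: "ln (1 + b) \<le> 2 * ln b"
      using ab by (simp add: ln_realpow)
    have "1 + L \<le> 1 + (ln (fact CARD('r)) + CARD('r) * ln (1 + b))"
      unfolding L_def b_def by (intro add_left_mono log_volume_le)
    also have "\<dots> \<le> 1 * ln b + (ln (fact CARD('r)) * ln b + CARD('r) * (2 * ln b))"
      using ln1 ln2 mult_left_mono[OF ln1, of "ln (fact CARD('r))"]
      by (intro add_mono mult_left_mono) auto
    also have "\<dots> = (1 + ln (fact CARD('r)) + 2 * CARD('r)) * ln b"
      by (simp add: algebra_simps)
    finally have "2 * (c * (1 + L)) \<le> 2 * (c * ((1 + ln (fact CARD('r)) + 2 * CARD('r)) * ln b))"
      by (intro mult_left_mono) (auto simp: c_def)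
    then have "2 * (c * (1 + L)) \<le> K * ln b"
      by (simp add: K_def mult.assoc)
    with 1 have "(norm d)\<^sup>2 * a \<le> K * ln b"
      by (simp add: dot_square_norm mult.commute)
    then have "(norm d)\<^sup>2 \<le> K * (ln b / a)"
      using ab by (simp add: pos_le_divide_eq)
    then have "norm d \<le> sqrt (K * (ln b / a))"
      by (rule real_le_rsqrt)
    then show ?case
      by (simp only: d_def a_def b_def real_sqrt_mult)
  qed
  then show ?thesis
    by blast
qed

subsection \<open>The minimiser of the penalised cost\<close>

text \<open>The linear term pairs \<open>h\<close> with G b minus the sum of
  \<open>y (k + 1) *\<^sub>R x k\<close>, which the normal equations turn into G times the least
  squares estimate.\<close>

lemma residual_expansion:
  assumes "lambda_min x N > 0"
  shows "(\<Sum>k=1..N. (y (k + 1) - (b + h) \<bullet> x k)\<^sup>2) =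
    (\<Sum>k=1..N. (y (k + 1) - b \<bullet> x k)\<^sup>2) + h \<bullet> (gram x N *v h)
      + 2 * (h \<bullet> (gram x N *v (b - ls_estimate x y N)))"
proof -
  have "h \<bullet> (gram x N *v (b - ls_estimate x y N)) =
      h \<bullet> (gram x N *v b) - h \<bullet> (\<Sum>k=1..N. y (k + 1) *\<^sub>R x k)"
    unfolding matrix_vector_mult_diff_distrib gram_ls_estimate[OF assms] by (simp add: inner_diff)
  also have "\<dots> = (\<Sum>k=1..N. (x k \<bullet> h) * (x k \<bullet> b) - y (k + 1) * (h \<bullet> x k))"
    unfolding inner_gram inner_sum_right sum_subtractf by simp
  finally have *: "h \<bullet> (gram x N *v (b - ls_estimate x y N)) =
    (\<Sum>k = 1..N. (x k \<bullet> h) * (x k \<bullet> b) - y (k + 1) * (h \<bullet> x k))" .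
  show ?thesis
    unfolding * unfolding inner_gram sum_distrib_left sum.distrib[symmetric]
    by (intro sum.cong refl) (simp add: power2_eq_square inner_add inner_commute algebra_simps)
qed

text \<open>\<open>arg_min\<close> is a choice, so a minimiser must be exhibited. The cost is at
  least \<open>lambda_min\<close> times the squared distance to the least squares estimate
  \<open>c\<close>; outside the ball of radius \<open>\<rho>\<close> it exceeds \<open>J c\<close>,
  and inside compactness applies.\<close>

lemma sparse_estimate_minimal:
  assumes pos: "lambda_min x N > 0" and lam: "lam N \<ge> 0"
  shows "lasso_cost x y lam N (sparse_estimate x y lam N) \<le> lasso_cost x y lam N b"
proof -
  define J where "J = lasso_cost x y lam N"
  define c where "c = ls_estimate x y N"
  define \<rho> where "\<rho> = sqrt (J c / lambda_min x N)"
  have lower: "lambda_min x N * (norm (b - c))\<^sup>2 \<le> J b" for b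
  proof -
    have "lambda_min x N * (norm (b - c))\<^sup>2 \<le> (b - c) \<bullet> (gram x N *v (b - c))"
      using lambda_min_bound by (metis dot_square_norm)
    also have "\<dots> \<le> (\<Sum>k=1..N. (y (k + 1) - b \<bullet> x k)\<^sup>2)"
      using residual_expansion[OF pos, of y c "b - c"] by (auto simp: c_def sum_nonneg)
    also have "\<dots> \<le> J b"
      using lam by (simp add: J_def lasso_cost_def sum_nonneg)
    finally show ?thesis .
  qed
  have Jc: "0 \<le> J c"
    using lower[of c] by simp
  have "continuous_on (cball c \<rho>) J"
    unfolding J_def lasso_cost_def by (intro continuous_intros)
  moreover have "cball c \<rho> \<noteq> {}"
    using Jc pos by (simp add: \<rho>_def not_less)
  ultimately obtain m where m: "m \<in> cball c \<rho>" "\<And>b. b \<in> cball c \<rho> \<Longrightarrow> J m \<le> J b"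
    using continuous_attains_inf[OF compact_cball] by blast
  have "J m \<le> J b" for b
  proof (cases "b \<in> cball c \<rho>")
    case False
    then have "sqrt (J c / lambda_min x N) < norm (b - c)"
      by (simp add: \<rho>_def dist_norm norm_minus_commute)
    then have "(sqrt (J c / lambda_min x N))\<^sup>2 < (norm (b - c))\<^sup>2"
      using pos Jc by (intro power_strict_mono) auto
    then have "J c < lambda_min x N * (norm (b - c))\<^sup>2"
      using pos Jc by (simp add: field_simps)
    then show ?thesis
      using lower[of b] m(2)[of c] Jc pos by (simp add: \<rho>_def)
  qed (use m in auto)
  then have "is_arg_min J (\<lambda>_. True) m"
    by (simp add: is_arg_min_linorder)
  then have "is_arg_min J (\<lambda>_. True) (arg_min J (\<lambda>_. True))"
    unfolding arg_min_def by (rule someI)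
  then show ?thesis
    by (simp add: is_arg_min_linorder J_def sparse_estimate_def)
qed

text \<open>The convention \<open>sign 0 = 1\<close> matters: a component equal to 0 is also moved
  away from 0 by the full shift.\<close>

lemma shifted_estimate_abs:
  assumes "0 \<le> ln (lambda_max x N) / lambda_min x N"
  shows "\<bar>shifted_estimate x y N $ l\<bar> =
    \<bar>ls_estimate x y N $ l\<bar> + sqrt (ln (lambda_max x N) / lambda_min x N)"
proof -
  have "\<bar>t + sign t * d\<bar> = \<bar>t\<bar> + d" if "d \<ge> 0" for t d
    using that by (cases "t \<ge> 0") (simp_all add: sign_def)
  then show ?thesis
    using assms by (simp add: shifted_estimate_def)
qed

text \<open>In the comparison with \<open>\<theta>\<close>, coordinates where
  \<open>\<theta>\<close> vanishes contribute a penalty difference of at most 0. Only the weights of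
  nonzero coordinates remain, and these will stay bounded.\<close>

lemma sparse_estimate_error:
  fixes \<theta> :: "real ^ 'r" and x y lam N
  defines "e \<equiv> sparse_estimate x y lam N - \<theta>"
  assumes pos: "lambda_min x N > 0" and lam: "lam N \<ge> 0"
  shows "lambda_min x N * norm e \<le> 2 * lambda_max x N * norm (ls_estimate x y N - \<theta>)
    + lam N * (\<Sum>l | \<theta> $ l \<noteq> 0. 1 / \<bar>shifted_estimate x y N $ l\<bar>)"
proof (cases "e = 0")
  case True
  then show ?thesis
    using lam order_trans[OF lambda_min_nonneg lambda_min_le_max, of x N] by (simp add: sum_nonneg)
next
  case False
  define s where "s = (\<lambda>l. 1 / \<bar>shifted_estimate x y N $ l\<bar>)"
  have s: "s l \<ge> 0" for l
    by (simp add: s_def)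
  have e: "sparse_estimate x y lam N = \<theta> + e"
    by (simp add: e_def)
  have "e \<bullet> (gram x N *v e) + 2 * (e \<bullet> (gram x N *v (\<theta> - ls_estimate x y N)))
      \<le> lam N * (\<Sum>l\<in>UNIV. s l * \<bar>\<theta> $ l\<bar>) - lam N * (\<Sum>l\<in>UNIV. s l * \<bar>(\<theta> + e) $ l\<bar>)"
    using sparse_estimate_minimal[of x N lam y, OF pos lam, of \<theta>] residual_expansion[OF pos, of y \<theta> e]
    by (simp add: lasso_cost_def e s_def)
  also have "\<dots> = lam N * (\<Sum>l\<in>UNIV. s l * (\<bar>\<theta> $ l\<bar> - \<bar>(\<theta> + e) $ l\<bar>))"
    by (simp add: right_diff_distrib sum_subtractf)
  also have "\<dots> \<le> lam N * (\<Sum>l\<in>UNIV. if \<theta> $ l \<noteq> 0 then s l * norm e else 0)"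
  proof (intro mult_left_mono sum_mono lam)
    fix l
    have "\<bar>\<theta> $ l\<bar> - \<bar>(\<theta> + e) $ l\<bar> \<le> norm e"
      using component_le_norm_cart[of e l] by simp
    then show "s l * (\<bar>\<theta> $ l\<bar> - \<bar>(\<theta> + e) $ l\<bar>) \<le> (if \<theta> $ l \<noteq> 0 then s l * norm e else 0)"
      using s[of l] by (auto intro: mult_left_mono)
  qed
  also have "\<dots> = lam N * (\<Sum>l | \<theta> $ l \<noteq> 0. s l) * norm e"
    by (simp add: sum.If_cases sum_distrib_right)
  finally have "e \<bullet> (gram x N *v e) \<le> lam N * (\<Sum>l | \<theta> $ l \<noteq> 0. s l) * norm e
      + 2 * \<bar>e \<bullet> (gram x N *v (\<theta> - ls_estimate x y N))\<bar>"
    by linarith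
  also have "\<dots> \<le> lam N * (\<Sum>l | \<theta> $ l \<noteq> 0. s l) * norm e
      + 2 * (lambda_max x N * norm e * norm (\<theta> - ls_estimate x y N))"
    by (intro add_left_mono mult_left_mono gram_inner_bound) auto
  finally have "e \<bullet> (gram x N *v e) \<le> lam N * (\<Sum>l | \<theta> $ l \<noteq> 0. s l) * norm e
      + 2 * (lambda_max x N * norm e * norm (\<theta> - ls_estimate x y N))" .
  then have "lambda_min x N * norm e * norm e \<le>
      (2 * lambda_max x N * norm (ls_estimate x y N - \<theta>) + lam N * (\<Sum>l | \<theta> $ l \<noteq> 0. s l)) * norm e"
    using lambda_min_bound[of x N e]
    by (simp add: dot_square_norm power2_eq_square norm_minus_commute algebra_simps)
  then show ?thesis
    using False by (simp add: s_def)
qed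

text \<open>The competitor \<open>b + h\<close> cancels component \<open>j\<close>. As
  \<open>\<theta> $ j = 0\<close>, \<open>norm h <= norm (b - \<theta>)\<close>, so one factor
  \<open>norm h\<close> of the quadratic term can be traded; together with the linear term this
  gives 1 + 2 = 3.\<close>

lemma sparse_estimate_nonzero_component:
  fixes \<theta> :: "real ^ 'r"
  assumes pos: "lambda_min x N > 0" and lam: "lam N \<ge> 0"
    and j: "\<theta> $ j = 0" "sparse_estimate x y lam N $ j \<noteq> 0"
  shows "lam N / \<bar>shifted_estimate x y N $ j\<bar> \<le>
    3 * lambda_max x N * norm (sparse_estimate x y lam N - \<theta>)
    + 2 * lambda_max x N * norm (ls_estimate x y N - \<theta>)"
proof -
  define b where "b = sparse_estimate x y lam N"
  define h where "h = - (b $ j) *\<^sub>R axis j (1 :: real)"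
  define s where "s = (\<lambda>l. 1 / \<bar>shifted_estimate x y N $ l\<bar>)"
  have h: "norm h = \<bar>b $ j\<bar>"
    by (simp add: h_def)
  have b_eq: "b = b + h + b $ j *\<^sub>R axis j 1"
    by (simp add: h_def)
  have le: "norm h \<le> norm (b - \<theta>)"
    using component_le_norm_cart[of "b - \<theta>" j] j by (simp add: h)
  have lmax: "0 \<le> lambda_max x N"
    using lambda_min_nonneg lambda_min_le_max order_trans by blast
  have "(\<Sum>l\<in>UNIV. s l * \<bar>b $ l\<bar>) = s j * \<bar>b $ j\<bar> + (\<Sum>l\<in>UNIV - {j}. s l * \<bar>b $ l\<bar>)"
    by (simp add: sum.remove)
  moreover have "(\<Sum>l\<in>UNIV. s l * \<bar>(b + h) $ l\<bar>) = (\<Sum>l\<in>UNIV - {j}. s l * \<bar>b $ l\<bar>)"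
    by (simp add: sum.remove[of UNIV j] h_def) (auto intro!: sum.cong simp: axis_def)
  ultimately have pen: "lam N * (\<Sum>l\<in>UNIV. s l * \<bar>b $ l\<bar>) - lam N * (\<Sum>l\<in>UNIV. s l * \<bar>(b + h) $ l\<bar>)
      = lam N * s j * norm h"
    by (simp add: h algebra_simps)
  have "lam N * s j * norm h \<le> h \<bullet> (gram x N *v h) + 2 * (h \<bullet> (gram x N *v (b - ls_estimate x y N)))"
    using sparse_estimate_minimal[of x N lam y, OF pos lam, of "b + h"] residual_expansion[OF pos, of y b h] pen
    by (simp add: lasso_cost_def s_def flip: b_def)
  also have "\<dots> \<le> lambda_max x N * norm h * norm h + 2 * (lambda_max x N * norm h * norm (b - ls_estimate x y N))"
    using gram_inner_bound[of h x N h] gram_inner_bound[of h x N "b - ls_estimate x y N"]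
    by linarith
  also have "\<dots> \<le> lambda_max x N * norm h * norm (b - \<theta>)
      + 2 * (lambda_max x N * norm h * (norm (b - \<theta>) + norm (ls_estimate x y N - \<theta>)))"
    using le lmax norm_triangle_ineq4[of "b - \<theta>" "ls_estimate x y N - \<theta>"]
    by (intro add_mono mult_left_mono) auto
  also have "\<dots> = (3 * lambda_max x N * norm (b - \<theta>) + 2 * lambda_max x N * norm (ls_estimate x y N - \<theta>)) * norm h"
    by (simp add: algebra_simps)
  finally show ?thesis
    using j by (simp add: h s_def b_def del: times_divide_eq_left times_divide_eq_right) simp
qed

text \<open>A statement about one fixed path. Dividing the error bound by \<open>lambda_min\<close>
  leaves multiples of \<open>\<rho>\<close> and \<open>lam / a\<close>, both tending to 0; the
  second claim uses this rate and not just consistency.\<close>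

lemma
  fixes x :: "nat \<Rightarrow> real ^ 'r" and \<theta> :: "real ^ 'r" and y lam :: "nat \<Rightarrow> real"
  defines "\<delta> \<equiv> \<lambda>N. sqrt (ln (lambda_max x N) / lambda_min x N)"
  assumes ratio: "(\<lambda>N. lambda_max x N / lambda_min x N * \<delta> N) \<longlonglongrightarrow> 0"
    and lam_pos: "\<forall>N\<ge>1. lam N > 0"
    and lmin: "filterlim (lambda_min x) at_top sequentially"
    and upper: "lam \<in> o(lambda_min x)"
    and lower: "(\<lambda>N. lambda_max x N * \<delta> N) \<in> o(lam)"
    and ls: "\<forall>\<^sub>F N in sequentially. norm (ls_estimate x y N - \<theta>) \<le> C * \<delta> N"
  shows sparse_estimate_tendsto: "sparse_estimate x y lam \<longlonglongrightarrow> \<theta>"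
    and sparse_estimate_eventually_zero:
      "\<forall>\<^sub>F N in sequentially. \<forall>j. \<theta> $ j = 0 \<longrightarrow> sparse_estimate x y lam N $ j = 0"
proof -
  define a where "a = lambda_min x"
  define b where "b = lambda_max x"
  define \<rho> where "\<rho> = (\<lambda>N. b N / a N * \<delta> N)"
  define est where "est = (\<lambda>N. sparse_estimate x y lam N)"
  \<comment> \<open>Eventually the estimate of a nonzero coordinate has at least half the true size,
    so its weight is at most the summand here.\<close>
  define D where "D = (\<Sum>l | \<theta> $ l \<noteq> 0. 2 / \<bar>\<theta> $ l\<bar>)"
  define c where "c = \<bar>C\<bar>"
  have \<rho>: "\<rho> \<longlonglongrightarrow> 0"
    using ratio by (simp add: \<rho>_def a_def b_def)
  have ab: "a N \<le> b N" for N
    by (simp add: a_def b_def lambda_min_le_max)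
  have D: "D \<ge> 0" and c: "c \<ge> 0"
    by (auto simp: D_def c_def intro!: sum_nonneg)
  have "\<forall>\<^sub>F N in sequentially. a N > 1"
    using lmin unfolding a_def by (simp add: filterlim_at_top_dense)
  \<comment> \<open>Since \<open>b N / a N >= 1\<close>, \<open>\<delta> N <= \<rho> N\<close>; thus
    the ratio hypothesis also forces \<open>\<delta>\<close> to 0.\<close>
  then have ev_a: "\<forall>\<^sub>F N in sequentially. a N > 1 \<and> b N > 1 \<and> \<delta> N > 0 \<and> \<delta> N \<le> \<rho> N"
  proof eventually_elim
    case (elim N)
    then have "b N > 1"
      using ab[of N] by simp
    then have "\<delta> N > 0"
      using elim by (simp add: \<delta>_def flip: a_def b_def)
    then have "1 * \<delta> N \<le> \<rho> N"
      unfolding \<rho>_def using ab[of N] elim by (intro mult_right_mono) (auto simp: divide_simps)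
    with elim \<open>b N > 1\<close> \<open>\<delta> N > 0\<close> show ?case
      by simp
  qed
  have lam': "\<forall>\<^sub>F N in sequentially. lam N > 0"
    using lam_pos by (auto simp: eventually_sequentially)
  have ls': "\<forall>\<^sub>F N in sequentially. norm (ls_estimate x y N - \<theta>) \<le> c * \<delta> N"
    using ls ev_a
  proof eventually_elim
    case (elim N)
    then have "C * \<delta> N \<le> c * \<delta> N"
      by (intro mult_right_mono) (auto simp: c_def)
    with elim show ?case
      by linarith
  qed
  have lower': "\<forall>\<^sub>F N in sequentially. b N * \<delta> N \<le> lam N"
    using landau_o.smallD[OF lower zero_less_one] lam' by eventually_elim (auto simp: b_def)
  have "\<delta> \<longlonglongrightarrow> 0"
    using ev_a by (intro tendsto_sandwich[OF _ _ tendsto_const \<rho>]) (auto elim: eventually_mono)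
  then have c\<delta>: "(\<lambda>N. c * \<delta> N) \<longlonglongrightarrow> 0"
    by (rule tendsto_mult_right_zero)
  have "\<forall>\<^sub>F N in sequentially. c * \<delta> N < \<bar>\<theta> $ l\<bar> / 2" if "\<theta> $ l \<noteq> 0" for l
    using order_tendstoD(2)[OF c\<delta>, of "\<bar>\<theta> $ l\<bar> / 2"] that by simp
  then have "\<forall>\<^sub>F N in sequentially. \<forall>l\<in>{l. \<theta> $ l \<noteq> 0}. c * \<delta> N < \<bar>\<theta> $ l\<bar> / 2"
    by (intro eventually_ball_finite) auto
  then have weights: "\<forall>\<^sub>F N in sequentially. (\<Sum>l | \<theta> $ l \<noteq> 0. 1 / \<bar>shifted_estimate x y N $ l\<bar>) \<le> D"
    using ev_a ls'
  proof eventually_elim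
    case (elim N)
    show ?case
      unfolding D_def
    proof (rule sum_mono)
      fix l assume l: "l \<in> {l. \<theta> $ l \<noteq> 0}"
      have "\<bar>ls_estimate x y N $ l - \<theta> $ l\<bar> \<le> c * \<delta> N"
        using component_le_norm_cart[of "ls_estimate x y N - \<theta>" l] elim by simp
      then have "\<bar>\<theta> $ l\<bar> / 2 \<le> \<bar>ls_estimate x y N $ l\<bar>"
        using elim l by fastforce
      also have "\<dots> \<le> \<bar>shifted_estimate x y N $ l\<bar>"
        using elim by (subst shifted_estimate_abs) (auto simp flip: a_def b_def)
      finally show "1 / \<bar>shifted_estimate x y N $ l\<bar> \<le> 2 / \<bar>\<theta> $ l\<bar>"
        using l by (simp add: divide_simps)
    qed
  qed
  have err: "\<forall>\<^sub>F N in sequentially. a N * norm (est N - \<theta>) \<le> 2 * c * (b N * \<delta> N) + lam N * D"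
    using ev_a ls' lam' weights
  proof eventually_elim
    case (elim N)
    have "a N * norm (est N - \<theta>) \<le> 2 * b N * norm (ls_estimate x y N - \<theta>)
        + lam N * (\<Sum>l | \<theta> $ l \<noteq> 0. 1 / \<bar>shifted_estimate x y N $ l\<bar>)"
      using elim unfolding a_def b_def est_def by (intro sparse_estimate_error) auto
    also have "\<dots> \<le> 2 * b N * (c * \<delta> N) + lam N * D"
      using elim by (intro add_mono mult_left_mono) auto
    finally show ?case
      by (simp add: mult_ac)
  qed
  have "(\<lambda>N. lam N / a N) \<longlonglongrightarrow> 0"
    using upper unfolding a_def by (rule smalloD_tendsto)
  then have "(\<lambda>N. 2 * c * \<rho> N + lam N / a N * D) \<longlonglongrightarrow> 2 * c * 0 + 0 * D"
    using \<rho> by (intro tendsto_intros)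
  then have "(\<lambda>N. 2 * c * \<rho> N + lam N / a N * D) \<longlonglongrightarrow> 0"
    by simp
  moreover have "\<forall>\<^sub>F N in sequentially. norm (est N - \<theta>) \<le> 2 * c * \<rho> N + lam N / a N * D"
    using err ev_a
  proof eventually_elim
    case (elim N)
    then have "norm (est N - \<theta>) \<le> (2 * c * (b N * \<delta> N) + lam N * D) / a N"
      by (simp add: pos_le_divide_eq mult.commute)
    then show ?case
      by (simp add: \<rho>_def add_divide_distrib)
  qed
  ultimately have "(\<lambda>N. est N - \<theta>) \<longlonglongrightarrow> 0"
    by (rule Lim_null_comparison[rotated])
  then show "sparse_estimate x y lam \<longlonglongrightarrow> \<theta>"
    unfolding est_def using LIM_zero_iff by blast

  \<comment> \<open>The shifted estimate is at most \<open>(c + 1) * \<delta>\<close>; after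
    multiplication by \<open>\<delta>\<close> the two error terms are at most
    \<open>(2 * c + D) * \<rho> * lam\<close> and \<open>c * \<rho> * lam\<close>. The result is
    \<open>lam <= K * \<rho> * lam\<close>, a contradiction once
    \<open>K * \<rho> < 1\<close>.\<close>
  define K where "K = (c + 1) * (3 * (2 * c + D) + 2 * c)"
  have "(\<lambda>N. K * \<rho> N) \<longlonglongrightarrow> 0"
    using \<rho> by (rule tendsto_mult_right_zero)
  then have "\<forall>\<^sub>F N in sequentially. K * \<rho> N < 1"
    by (rule order_tendstoD) simp
  then show "\<forall>\<^sub>F N in sequentially. \<forall>j. \<theta> $ j = 0 \<longrightarrow> sparse_estimate x y lam N $ j = 0"
    using err ev_a ls' lam' lower'
  proof eventually_elim
    case (elim N)
    show ?case
    proof (intro allI impI, rule ccontr)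
      fix j assume j: "\<theta> $ j = 0" "sparse_estimate x y lam N $ j \<noteq> 0"
      have "lam N / \<bar>shifted_estimate x y N $ j\<bar> \<le> 3 * b N * norm (est N - \<theta>) + 2 * b N * norm (ls_estimate x y N - \<theta>)"
        unfolding est_def b_def using elim j
        by (intro sparse_estimate_nonzero_component) (auto simp flip: a_def)
      also have "\<dots> \<le> 3 * b N * norm (est N - \<theta>) + 2 * b N * (c * \<delta> N)"
        using elim by (intro add_left_mono mult_left_mono) auto
      finally have *: "lam N / \<bar>shifted_estimate x y N $ j\<bar> \<le> 3 * b N * norm (est N - \<theta>) + 2 * b N * (c * \<delta> N)" .
      have s: "\<bar>shifted_estimate x y N $ j\<bar> = \<bar>ls_estimate x y N $ j\<bar> + \<delta> N"
        unfolding \<delta>_def using elim by (intro shifted_estimate_abs) (auto simp flip: a_def b_def)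
      have "\<bar>ls_estimate x y N $ j\<bar> \<le> c * \<delta> N"
        using component_le_norm_cart[of "ls_estimate x y N - \<theta>" j] elim j by simp
      then have s_le: "\<bar>shifted_estimate x y N $ j\<bar> \<le> (c + 1) * \<delta> N" and s_pos: "\<bar>shifted_estimate x y N $ j\<bar> > 0"
        using s elim by (auto simp: algebra_simps)
      have "b N / a N * (a N * norm (est N - \<theta>)) \<le> b N / a N * (2 * c * (b N * \<delta> N) + lam N * D)"
        using elim by (intro mult_left_mono) auto
      also have "\<dots> \<le> b N / a N * (2 * c * lam N + lam N * D)"
        using elim c D by (intro mult_left_mono add_mono) auto
      finally have "b N * norm (est N - \<theta>) \<le> b N / a N * (2 * c + D) * lam N"
        using elim by (simp add: algebra_simps)
      then have 1: "\<delta> N * (b N * norm (est N - \<theta>)) \<le> \<delta> N * (b N / a N * (2 * c + D) * lam N)"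
        using elim by (intro mult_left_mono) auto
      have 2: "c * (\<delta> N * (b N * \<delta> N)) \<le> c * (\<rho> N * lam N)"
        using elim c by (intro mult_left_mono mult_mono) auto
      have "lam N \<le> (3 * b N * norm (est N - \<theta>) + 2 * b N * (c * \<delta> N)) * \<bar>shifted_estimate x y N $ j\<bar>"
        using * s_pos by (simp add: divide_le_eq)
      also have "\<dots> \<le> (3 * b N * norm (est N - \<theta>) + 2 * b N * (c * \<delta> N)) * ((c + 1) * \<delta> N)"
        using s_le elim c by (intro mult_left_mono) auto
      also have "\<dots> = (c + 1) * (3 * (\<delta> N * (b N * norm (est N - \<theta>))) + 2 * (c * (\<delta> N * (b N * \<delta> N))))"
        by (simp add: algebra_simps)
      also have "\<dots> \<le> (c + 1) * (3 * (\<delta> N * (b N / a N * (2 * c + D) * lam N)) + 2 * (c * (\<rho> N * lam N)))"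
        using 1 2 c by (intro mult_left_mono) linarith+
      also have "\<dots> = K * \<rho> N * lam N"
        by (simp add: K_def \<rho>_def algebra_simps add_divide_distrib)
      also have "\<dots> < 1 * lam N"
        using elim by (intro mult_strict_right_mono) auto
      finally show False
        by simp
    qed
  qed
qed

section \<open>Measurability of the observation algebras, and the theorem\<close>

lemma sets_vimage_algebra_subset:
  assumes "f \<in> measurable M N"
  shows "sets (vimage_algebra (space M) f N) \<subseteq> sets M"
  unfolding sets_vimage_algebra using assms by (intro sets.sigma_sets_subset) (auto dest: measurable_sets)

lemma
  assumes meas: "\<And>k. y k \<in> borel_measurable M" "\<And>k. w k \<in> borel_measurable M"
    "\<And>k. u k \<in> borel_measurable M" "\<And>k. w' k \<in> borel_measurable M"
  shows subalgebra_observation_algebra: "subalgebra M (observation_algebra M y u w w' k)"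
    and sets_observation_algebra_Suc:
      "sets (observation_algebra M y u w w' k) \<subseteq> sets (observation_algebra M y u w w' (Suc k))"
proof -
  define G where "G = (\<lambda>k.
    (\<Union>i\<in>{0..k}. sets (vimage_algebra (space M) (y i) borel)) \<union>
    (\<Union>i\<in>{0..<k}. sets (vimage_algebra (space M) (u i) borel)) \<union>
    (\<Union>i\<in>{0..k}. sets (vimage_algebra (space M) (w i) borel)) \<union>
    (\<Union>i\<in>{0..k}. sets (vimage_algebra (space M) (w' i) borel)))"
  have sub: "G k \<subseteq> sets M" for k
    unfolding G_def by (intro Un_least UN_least sets_vimage_algebra_subset meas)
  have "observation_algebra M y u w w' k = sigma (space M) (G k)" for k
    by (simp add: observation_algebra_def G_def)
  moreover have "G k \<subseteq> Pow (space M)" for k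
    using sub sets.space_closed by (rule order_trans)
  ultimately have sets: "sets (observation_algebra M y u w w' k) = sigma_sets (space M) (G k)" for k
    by (simp add: sets_measure_of)
  show "subalgebra M (observation_algebra M y u w w' k)"
    unfolding subalgebra_def sets using sets.sigma_sets_subset[OF sub]
    by (simp add: observation_algebra_def space_measure_of_conv)
  have "G k \<subseteq> G (Suc k)"
    unfolding G_def by (intro Un_mono UN_mono) auto
  then show "sets (observation_algebra M y u w w' k) \<subseteq> sets (observation_algebra M y u w w' (Suc k))"
    unfolding sets by (rule sigma_sets_mono')
qed

theorem theorem1:
  fixes M :: "'a measure"
    and y w :: "nat \<Rightarrow> 'a \<Rightarrow> real"
    and u :: "nat \<Rightarrow> 'a \<Rightarrow> 'u::euclidean_space"
    and w' :: "nat \<Rightarrow> 'a \<Rightarrow> 'v::euclidean_space"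
    and \<phi> :: "nat \<Rightarrow> 'a \<Rightarrow> real ^ 'r"
    and \<theta> :: "real ^ 'r"
    and lam :: "nat \<Rightarrow> 'a \<Rightarrow> real"
    and \<gamma> :: real
    and F :: "nat \<Rightarrow> 'a measure"
    and Astar :: "'r set"
    and \<beta> :: "nat \<Rightarrow> 'a \<Rightarrow> real ^ 'r"
  defines "F \<equiv> observation_algebra M y u w w'"
    and "Astar \<equiv> {j. \<theta> $ j = 0}"
    and "\<beta> \<equiv> (\<lambda>N \<omega>. sparse_estimate (\<lambda>k. \<phi> k \<omega>) (\<lambda>k. y k \<omega>) (\<lambda>n. lam n \<omega>) N)"
  assumes "prob_space M"
    and rv: "\<And>k. y k \<in> borel_measurable M" "\<And>k. w k \<in> borel_measurable M"
      "\<And>k. u k \<in> borel_measurable M" "\<And>k. w' k \<in> borel_measurable M"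
      "\<And>k. \<phi> k \<in> borel_measurable M"
    and system: "\<And>k \<omega>. \<omega> \<in> space M \<Longrightarrow> y (k + 1) \<omega> = \<theta> \<bullet> \<phi> k \<omega> + w (k + 1) \<omega>"
    and A1_mds: "martingale_difference M F w"
    and A1_gamma: "\<gamma> > 2"
    and A1_moment: "AE \<omega> in M.
      (SUP k\<in>{1..}. nn_cond_exp M (F k) (\<lambda>\<omega>. ennreal (\<bar>w (k + 1) \<omega>\<bar> powr \<gamma>)) \<omega>) < \<infinity>"
    and A2: "\<And>k. k \<ge> 1 \<Longrightarrow> \<phi> k \<in> borel_measurable (F k)"
    and A3: "AE \<omega> in M.
      (\<lambda>N. lambda_max (\<lambda>k. \<phi> k \<omega>) N / lambda_min (\<lambda>k. \<phi> k \<omega>) N *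
        sqrt (ln (lambda_max (\<lambda>k. \<phi> k \<omega>) N) / lambda_min (\<lambda>k. \<phi> k \<omega>) N)) \<longlonglongrightarrow> 0"
    and A4_pos: "AE \<omega> in M. \<forall>N\<ge>1. lam N \<omega> > 0"
    and A4_infinity: "AE \<omega> in M. filterlim (\<lambda>N. lam N \<omega>) at_top sequentially"
    and A4_upper: "AE \<omega> in M. (\<lambda>N. lam N \<omega>) \<in> o(\<lambda>N. lambda_min (\<lambda>k. \<phi> k \<omega>) N)"
    and A4_lower: "AE \<omega> in M.
      (\<lambda>N. lambda_max (\<lambda>k. \<phi> k \<omega>) N *
        sqrt (ln (lambda_max (\<lambda>k. \<phi> k \<omega>) N) / lambda_min (\<lambda>k. \<phi> k \<omega>) N)) \<in> o(\<lambda>N. lam N \<omega>)"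
  shows "(\<exists>\<Omega>\<^sub>0 \<in> sets M. measure M \<Omega>\<^sub>0 = 1 \<and>
            (\<forall>\<omega>\<in>\<Omega>\<^sub>0. \<exists>N\<^sub>0. \<forall>j\<in>Astar. \<forall>N\<ge>N\<^sub>0. \<beta> N \<omega> $ j = 0)) \<and>
         (\<forall>i\<in>UNIV - Astar. AE \<omega> in M. (\<lambda>N. \<beta> N \<omega> $ i) \<longlonglongrightarrow> \<theta> $ i)"
proof -
  interpret prob_space M
    by fact
  \<comment> \<open>The hypotheses on the noise and the regressors start at time 1, hence the shift.\<close>
  interpret filtered_prob_space M "\<lambda>n. F (Suc n)"
    unfolding F_def
    by unfold_locales (intro subalgebra_observation_algebra sets_observation_algebra_Suc rv)+
  have w_int: "integrable M (w (n + 2))" and w_meas: "w (n + 2) \<in> borel_measurable (F (Suc (Suc n)))"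
    and w_centered: "AE \<omega> in M. real_cond_exp M (F (Suc n)) (w (n + 2)) \<omega> = 0" for n
    using A1_mds by (auto simp: martingale_difference_def dest!: spec[of _ "Suc n"] spec[of _ "n + 2"])
  have "AE \<omega> in M. (SUP n. nn_cond_exp M (F (Suc n)) (\<lambda>\<omega>. ennreal (\<bar>w (n + 2) \<omega>\<bar> powr \<gamma>)) \<omega>) < \<infinity>"
    using A1_moment
  proof eventually_elim
    case (elim \<omega>)
    have "(SUP n. nn_cond_exp M (F (Suc n)) (\<lambda>\<omega>. ennreal (\<bar>w (n + 2) \<omega>\<bar> powr \<gamma>)) \<omega>)
        \<le> (SUP k\<in>{1..}. nn_cond_exp M (F k) (\<lambda>\<omega>. ennreal (\<bar>w (k + 1) \<omega>\<bar> powr \<gamma>)) \<omega>)"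
    proof (rule SUP_least)
      fix n
      show "nn_cond_exp M (F (Suc n)) (\<lambda>\<omega>. ennreal (\<bar>w (n + 2) \<omega>\<bar> powr \<gamma>)) \<omega>
          \<le> (SUP k\<in>{1..}. nn_cond_exp M (F k) (\<lambda>\<omega>. ennreal (\<bar>w (k + 1) \<omega>\<bar> powr \<gamma>)) \<omega>)"
        by (rule SUP_upper2[of "Suc n"]) simp_all
    qed
    with elim show ?case
      by (rule order_le_less_trans[rotated])
  qed
  then have self_normalized_bound: "AE \<omega> in M. \<exists>C. \<forall>N. self_normalized (\<lambda>k. \<phi> (Suc k) \<omega>) (\<lambda>k. w (k + 2) \<omega>) N
      \<le> C * (1 + log_volume (\<lambda>k. \<phi> (Suc k) \<omega>) N)"
    by (intro AE_self_normalized_bound_conditional_moments[OF A1_gamma A2 w_meas w_int w_centered]) simp_all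
  have main: "AE \<omega> in M. (\<lambda>N. \<beta> N \<omega>) \<longlonglongrightarrow> \<theta> \<and> (\<forall>\<^sub>F N in sequentially. \<forall>j\<in>Astar. \<beta> N \<omega> $ j = 0)"
    using self_normalized_bound A3 A4_pos A4_infinity A4_upper A4_lower AE_space
  proof eventually_elim
    case (elim \<omega>)
    \<comment> \<open>Divergence of \<open>lambda_min\<close> is derived: it eventually dominates
      \<open>lam\<close>, which tends to infinity.\<close>
    have "\<forall>\<^sub>F N in sequentially. lam N \<omega> \<le> lambda_min (\<lambda>k. \<phi> k \<omega>) N"
      using landau_o.smallD[OF elim(5) zero_less_one]
      by eventually_elim (simp add: lambda_min_nonneg)
    then have lmin: "filterlim (lambda_min (\<lambda>k. \<phi> k \<omega>)) at_top sequentially"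
      using elim(4) by (rule filterlim_at_top_mono[rotated])
    obtain C where "\<And>N. self_normalized (\<lambda>k. \<phi> (Suc k) \<omega>) (\<lambda>k. w (k + 2) \<omega>) N
      \<le> C * (1 + log_volume (\<lambda>k. \<phi> (Suc k) \<omega>) N)"
      using elim(1) by blast
    with lmin obtain K where "\<forall>\<^sub>F N in sequentially.
        norm (ls_estimate (\<lambda>k. \<phi> k \<omega>) (\<lambda>k. y k \<omega>) N - \<theta>)
        \<le> K * sqrt (ln (lambda_max (\<lambda>k. \<phi> k \<omega>) N) / lambda_min (\<lambda>k. \<phi> k \<omega>) N)"
      using ls_estimate_error[of "\<lambda>k. y k \<omega>" \<theta> "\<lambda>k. \<phi> k \<omega>" "\<lambda>k. w k \<omega>"] system[OF elim(7)] by blast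
    from sparse_estimate_tendsto[OF elim(2,3) lmin elim(5,6) this]
      sparse_estimate_eventually_zero[OF elim(2,3) lmin elim(5,6) this]
    show ?case
      by (simp add: \<beta>_def Astar_def)
  qed
  then obtain \<Omega> where \<Omega>: "\<Omega> \<in> sets M" "prob \<Omega> = 1"
      "\<And>\<omega>. \<omega> \<in> \<Omega> \<Longrightarrow> \<forall>\<^sub>F N in sequentially. \<forall>j\<in>Astar. \<beta> N \<omega> $ j = 0"
    by (rule AE_E_prob) blast
  moreover have "AE \<omega> in M. (\<lambda>N. \<beta> N \<omega> $ i) \<longlonglongrightarrow> \<theta> $ i" for i
    using main by eventually_elim (auto intro: tendsto_vec_nth)
  ultimately show ?thesis
    unfolding eventually_sequentially by (intro conjI bexI[of _ \<Omega>] ballI) blast+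
qed

end
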